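(* Let $u$ be a Leray–Hopf solution of the Navier–Stokes equations (unit viscosity, no force) on $\mathbb R^3$, on a time interval containing $(t_0-1,t_0)$; let $0<\sigma<1$, $r_k=2^{-k}$, $\ell_k=\sigma r_k$, $k\ge0$. With the quantities defined in the context, for every $p\in[2,4]$ and every $\eta\in(0,1)$, $$F_k^{\mathrm{com}}\le\eta P_k+\frac{C_{\mathrm{com}}^{\sharp}(\varphi)}{\eta}\,\widetilde{\mathcal S}_k^{(p)}+L_{k,\mathrm{inc}}^{\mathrm{com}},$$ where one may take $C_{\mathrm{com}}^{\sharp}(\varphi)=C_*\|\nabla\varphi\|_{L^1}^2$ with a universal numerical constant $C_*$, and the shell budget may be chosen as $$L_{k,\mathrm{inc}}^{\mathrm{com}}=C_\chi r_k^{-1}\iint_{\operatorname{supp}\nabla\chi_k}|\Omega_k|^2+C_\chi r_k\iint_{\operatorname{supp}\nabla\chi_k}|\nabla\cdot R_k|^2$$ with a constant $C_\chi$ depending only on the cutoff profile. Moreover, $$r_k\iint_{\operatorname{supp}\nabla\chi_k}|\nabla\cdot R_k|^2\le C_{\mathrm{com}}^{\sharp}(\varphi)\,\widetilde{\mathcal S}_{k,\mathrm{sh}}^{(p)}.$$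
   Context: Fix $(x_0,t_0)$; $Q_k=B_{r_k}(x_0)\times(t_0-r_k^2,t_0)$. Filter: $\varphi\in C_c^\infty(B_1(0))$, $\varphi\ge0$, $\int\varphi=1$, $\varphi_\ell(x)=\ell^{-3}\varphi(x/\ell)$; convolutions are in space. $U_k=\varphi_{\ell_k}*u$, $\Omega_k=\operatorname{curl}U_k$, $R_k=\varphi_{\ell_k}*(u\otimes u)-U_k\otimes U_k$. Cutoffs $\chi_k(x,t)=\chi((x-x_0)/r_k,(t-t_0)/r_k^2)$ are parabolic rescalings of one fixed smooth profile $0\le\chi\le1$ compactly supported in $B_1(0)\times(-1,0)$; $\nabla$ is the spatial gradient. $$F_k^{\mathrm{com}}=r_k\Bigl|\iint_{Q_k}\chi_k\,\Omega_k\cdot(\nabla\times\nabla\cdot R_k)\,dx\,dt\Bigr|,\qquad P_k=r_k\iint_{Q_k}\chi_k|\nabla\Omega_k|^2\,dx\,dt.$$ Increment defect: $\delta_zu(x,t)=u(x-z,t)-u(x,t)$; for $\ell>0$, $d\nu_\ell(z)=\varphi_\ell(z)dz$ and $d\mu_\ell(z)=\ell|\nabla\varphi_\ell(z)|\,\|\nabla\varphi\|_{L^1}^{-1}dz$ (probability measures), $$\mathfrak M_{\ell,p}(x,t)=\Bigl(\int|\delta_zu(x,t)|^pd\nu_\ell(z)\Bigr)^{1/p}+\Bigl(\int|\delta_zu(x,t)|^pd\mu_\ell(z)\Bigr)^{1/p},$$ $$\widetilde{\mathcal S}_k^{(p)}=\frac{r_k}{\ell_k^2}\iint\chi_k\,\mathfrak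 M_{\ell_k,p}^4\,dx\,dt\in[0,\infty],$$ and $\widetilde{\mathcal S}_{k,\mathrm{sh}}^{(p)}$ is the same expression with $\chi_k$ replaced by a cutoff supported on $\operatorname{supp}\nabla\chi_k$ and equal to one there (i.e. its indicator function). *)

theory Defs
  imports "HOL-Analysis.Analysis"
begin

section \<open>Smooth and compactly supported functions\<close>

primrec times_continuously_differentiable ::
    "nat \<Rightarrow> ('a::euclidean_space \<Rightarrow> 'b::real_normed_vector) \<Rightarrow> bool" where
  "times_continuously_differentiable 0 f \<longleftrightarrow> continuous_on UNIV f"
| "times_continuously_differentiable (Suc n) f \<longleftrightarrow>
     (\<forall>x. f differentiable (at x)) \<and>
     (\<forall>v. times_continuously_differentiable n (\<lambda>x. frechet_derivative f (at x) v))"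

definition smooth :: "('a::euclidean_space \<Rightarrow> 'b::real_normed_vector) \<Rightarrow> bool" where
  "smooth f \<longleftrightarrow> (\<forall>n. times_continuously_differentiable n f)"

definition supp :: "('a::topological_space \<Rightarrow> 'b::zero) \<Rightarrow> 'a set" where
  "supp f = closure {x. f x \<noteq> 0}"

definition Cc_infinity :: "'a set \<Rightarrow> ('a::euclidean_space \<Rightarrow> 'b::real_normed_vector) set" where
  "Cc_infinity S = {f. smooth f \<and> compact (supp f) \<and> supp f \<subseteq> S}"


section \<open>Vector calculus in space\<close>

text \<open>
  The library function \<^const>\<open>jacobian\<close> has the entries
  \<open>jacobian f (at x) $ i $ j = \<partial>\<^sub>j f\<^sub>i (x)\<close>. The inner product and the norm of
  \<^typ>\<open>real^3^3\<close> are the Frobenius ones.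
\<close>

definition grad :: "(real^3 \<Rightarrow> real) \<Rightarrow> real^3 \<Rightarrow> real^3" where
  "grad f x = (\<chi> j. frechet_derivative f (at x) (axis j 1))"

definition divergence :: "(real^3 \<Rightarrow> real^3) \<Rightarrow> real^3 \<Rightarrow> real" where
  "divergence f x = (\<Sum>j\<in>UNIV. jacobian f (at x) $ j $ j)"

definition curl :: "(real^3 \<Rightarrow> real^3) \<Rightarrow> real^3 \<Rightarrow> real^3" where
  "curl f x = (let D = jacobian f (at x) in
     vector [D$3$2 - D$2$3, D$1$3 - D$3$1, D$2$1 - D$1$2])"

definition tensor_divergence :: "(real^3 \<Rightarrow> real^3^3) \<Rightarrow> real^3 \<Rightarrow> real^3" where
  "tensor_divergence T x = (\<chi> i. divergence (\<lambda>y. T y $ i) x)"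

definition outer :: "real^3 \<Rightarrow> real^3 \<Rightarrow> real^3^3" where
  "outer a b = (\<chi> i j. a $ i * b $ j)"

definition convolution :: "(real^3 \<Rightarrow> real) \<Rightarrow> (real^3 \<Rightarrow> 'b::euclidean_space) \<Rightarrow> real^3 \<Rightarrow> 'b" where
  "convolution \<phi> f x = (LINT z|lborel. \<phi> z *\<^sub>R f (x - z))"


section \<open>Leray--Hopf solutions\<close>

text \<open>
  A velocity field is a curried function of time and space, \<open>u t x\<close>; space-time sets and
  integrals use pairs \<open>(x, t)\<close>.
\<close>

definition square_integrable :: "(real^3 \<Rightarrow> real^3) \<Rightarrow> bool" where
  "square_integrable f \<longleftrightarrow>
     f \<in> borel_measurable lborel \<and> integrable lborel (\<lambda>x. (norm (f x))\<^sup>2)"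

definition weakly_divergence_free :: "(real^3 \<Rightarrow> real^3) \<Rightarrow> bool" where
  "weakly_divergence_free f \<longleftrightarrow>
     (\<forall>\<psi>\<in>Cc_infinity UNIV. (LINT x|lborel. f x \<bullet> grad \<psi> x) = 0)"

definition weak_jacobian :: "(real^3 \<Rightarrow> real^3) \<Rightarrow> (real^3 \<Rightarrow> real^3^3) \<Rightarrow> bool" where
  "weak_jacobian f G \<longleftrightarrow>
     (\<forall>\<psi>\<in>Cc_infinity UNIV. \<forall>i j.
        (LINT x|lborel. f x $ i * grad \<psi> x $ j) = - (LINT x|lborel. G x $ i $ j * \<psi> x))"

text \<open>
  The distributional form of \<open>\<partial>\<^sub>t u + div (u \<otimes> u) + \<nabla>p = \<Delta>u\<close>, with the pressure eliminated by
  divergence-free test fields.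
\<close>

definition weak_navier_stokes ::
    "real set \<Rightarrow> (real \<Rightarrow> real^3 \<Rightarrow> real^3) \<Rightarrow> (real \<Rightarrow> real^3 \<Rightarrow> real^3^3) \<Rightarrow> bool" where
  "weak_navier_stokes I u G \<longleftrightarrow>
     (\<forall>\<psi>\<in>Cc_infinity (UNIV \<times> interior I).
        (\<forall>x t. divergence (\<lambda>y. \<psi> (y, t)) x = 0) \<longrightarrow>
        set_lebesgue_integral lborel (UNIV \<times> I) (\<lambda>(x, t).
            u t x \<bullet> frechet_derivative \<psi> (at (x, t)) (0, 1)
          + outer (u t x) (u t x) \<bullet> jacobian (\<lambda>y. \<psi> (y, t)) (at x)
          - G t x \<bullet> jacobian (\<lambda>y. \<psi> (y, t)) (at x)) = 0)"

definition energy_inequality ::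
    "(real \<Rightarrow> real^3 \<Rightarrow> real^3) \<Rightarrow> (real \<Rightarrow> real^3 \<Rightarrow> real^3^3) \<Rightarrow> real \<Rightarrow> real \<Rightarrow> bool" where
  "energy_inequality u G s t \<longleftrightarrow>
     (LINT x|lborel. (norm (u t x))\<^sup>2) / 2
       + set_lebesgue_integral lborel (UNIV \<times> {s..t}) (\<lambda>(x, \<tau>). (norm (G \<tau> x))\<^sup>2)
     \<le> (LINT x|lborel. (norm (u s x))\<^sup>2) / 2"

text \<open>
  A Leray--Hopf solution is given by its Borel, weakly continuous representative, so \<open>u t\<close> is
  meaningful for every \<open>t \<in> I\<close> and the supremum over \<open>I\<close> below is the essential supremum.
  The last clause covers every kind of interval: if \<open>I\<close> has a least element \<open>a\<close>, taking
  \<open>\<tau> = a\<close> shows that it is the usual energy inequality starting from the initial datum \<open>u a\<close>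
  (which is then also attained strongly in \<open>L\<^sup>2\<close>); if \<open>I\<close> has no least element, it asks for the
  energy inequality from starting times arbitrarily close to the left end, which is implied by
  the energy inequality from almost every starting time.
\<close>

definition leray_hopf :: "real set \<Rightarrow> (real \<Rightarrow> real^3 \<Rightarrow> real^3) \<Rightarrow> bool" where
  "leray_hopf I u \<longleftrightarrow>
     is_interval I \<and>
     set_borel_measurable lborel (UNIV \<times> I) (\<lambda>(x, t). u t x) \<and>
     (\<forall>t\<in>I. square_integrable (u t) \<and> weakly_divergence_free (u t)) \<and>
     (\<exists>M. \<forall>t\<in>I. (LINT x|lborel. (norm (u t x))\<^sup>2) \<le> M) \<and>
     (\<forall>w. square_integrable w \<longrightarrow> continuous_on I (\<lambda>t. LINT x|lborel. u t x \<bullet> w x)) \<and>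
     (\<exists>G. set_borel_measurable lborel (UNIV \<times> I) (\<lambda>(x, t). G t x) \<and>
          (AE t in lborel. t \<in> I \<longrightarrow> weak_jacobian (u t) (G t)) \<and>
          set_integrable lborel (UNIV \<times> I) (\<lambda>(x, t). (norm (G t x))\<^sup>2) \<and>
          weak_navier_stokes I u G \<and>
          (\<forall>\<tau>\<in>I. \<exists>s\<in>I. s \<le> \<tau> \<and> (\<forall>t\<in>I. s \<le> t \<longrightarrow> energy_inequality u G s t)))"


section \<open>Filter, cutoff and filtered fields\<close>

definition filter_kernel :: "(real^3 \<Rightarrow> real) \<Rightarrow> bool" where
  "filter_kernel \<phi> \<longleftrightarrow>
     \<phi> \<in> Cc_infinity (ball 0 1) \<and> (\<forall>x. 0 \<le> \<phi> x) \<and> (LINT x|lborel. \<phi> x) = 1"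

definition rescale :: "(real^3 \<Rightarrow> real) \<Rightarrow> real \<Rightarrow> real^3 \<Rightarrow> real" where
  "rescale \<phi> l x = \<phi> (x /\<^sub>R l) / l ^ 3"

definition grad_L1 :: "(real^3 \<Rightarrow> real) \<Rightarrow> real" where
  "grad_L1 \<phi> = (LINT x|lborel. norm (grad \<phi> x))"

text \<open>
  \<open>\<theta>\<close> is the fixed cutoff profile (the letter chi is taken by the vector binder) and
  \<open>cutoff\<close> its parabolic rescaling. The shell is the closed space-time support of the
  spatial gradient of the rescaled cutoff.
\<close>

definition cutoff_profile :: "((real^3) \<times> real \<Rightarrow> real) \<Rightarrow> bool" where
  "cutoff_profile \<theta> \<longleftrightarrow>
     \<theta> \<in> Cc_infinity (ball 0 1 \<times> {-1<..<0}) \<and> (\<forall>p. 0 \<le> \<theta> p \<and> \<theta> p \<le> 1)"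

definition radius :: "nat \<Rightarrow> real" where
  "radius k = (1 / 2) ^ k"

definition cylinder :: "real^3 \<Rightarrow> real \<Rightarrow> nat \<Rightarrow> ((real^3) \<times> real) set" where
  "cylinder x0 t0 k = ball x0 (radius k) \<times> {t0 - (radius k)\<^sup>2<..<t0}"

definition cutoff ::
    "((real^3) \<times> real \<Rightarrow> real) \<Rightarrow> real^3 \<Rightarrow> real \<Rightarrow> nat \<Rightarrow> (real^3) \<times> real \<Rightarrow> real" where
  "cutoff \<theta> x0 t0 k = (\<lambda>(x, t). \<theta> ((x - x0) /\<^sub>R radius k, (t - t0) / (radius k)\<^sup>2))"

definition shell ::
    "((real^3) \<times> real \<Rightarrow> real) \<Rightarrow> real^3 \<Rightarrow> real \<Rightarrow> nat \<Rightarrow> ((real^3) \<times> real) set" where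
  "shell \<theta> x0 t0 k = supp (\<lambda>(x, t). grad (\<lambda>y. cutoff \<theta> x0 t0 k (y, t)) x)"

definition filtered ::
    "(real^3 \<Rightarrow> real) \<Rightarrow> real \<Rightarrow> (real \<Rightarrow> real^3 \<Rightarrow> real^3) \<Rightarrow> real \<Rightarrow> real^3 \<Rightarrow> real^3" where
  "filtered \<phi> l u t = convolution (rescale \<phi> l) (u t)"

definition vorticity ::
    "(real^3 \<Rightarrow> real) \<Rightarrow> real \<Rightarrow> (real \<Rightarrow> real^3 \<Rightarrow> real^3) \<Rightarrow> real \<Rightarrow> real^3 \<Rightarrow> real^3" where
  "vorticity \<phi> l u t = curl (filtered \<phi> l u t)"

definition stress ::
    "(real^3 \<Rightarrow> real) \<Rightarrow> real \<Rightarrow> (real \<Rightarrow> real^3 \<Rightarrow> real^3) \<Rightarrow> real \<Rightarrow> real^3 \<Rightarrow> real^3^3" where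
  "stress \<phi> l u t x =
     convolution (rescale \<phi> l) (\<lambda>y. outer (u t y) (u t y)) x
       - outer (filtered \<phi> l u t x) (filtered \<phi> l u t x)"


section \<open>Increment defect\<close>

definition ennreal_powr :: "ennreal \<Rightarrow> real \<Rightarrow> ennreal" where
  "ennreal_powr a q = (if a = \<infinity> then \<infinity> else ennreal (enn2real a powr q))" \<comment> \<open>for \<open>q > 0\<close>\<close>

definition nu_measure :: "(real^3 \<Rightarrow> real) \<Rightarrow> real \<Rightarrow> (real^3) measure" where
  "nu_measure \<phi> l = density lborel (\<lambda>z. ennreal (rescale \<phi> l z))"

definition mu_measure :: "(real^3 \<Rightarrow> real) \<Rightarrow> real \<Rightarrow> (real^3) measure" where
  "mu_measure \<phi> l = density lborel (\<lambda>z. ennreal (l * norm (grad (rescale \<phi> l) z) / grad_L1 \<phi>))"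

definition increment :: "(real \<Rightarrow> real^3 \<Rightarrow> real^3) \<Rightarrow> real^3 \<Rightarrow> real^3 \<Rightarrow> real \<Rightarrow> real^3" where
  "increment u z x t = u t (x - z) - u t x"

definition increment_defect ::
    "(real^3 \<Rightarrow> real) \<Rightarrow> real \<Rightarrow> real \<Rightarrow> (real \<Rightarrow> real^3 \<Rightarrow> real^3) \<Rightarrow> real^3 \<Rightarrow> real \<Rightarrow> ennreal" where
  "increment_defect \<phi> l p u x t =
     ennreal_powr (\<integral>\<^sup>+z. ennreal (norm (increment u z x t) powr p) \<partial>nu_measure \<phi> l) (1 / p)
   + ennreal_powr (\<integral>\<^sup>+z. ennreal (norm (increment u z x t) powr p) \<partial>mu_measure \<phi> l) (1 / p)"

definition weighted_defect ::
    "(real^3 \<Rightarrow> real) \<Rightarrow> real \<Rightarrow> real \<Rightarrow> ((real^3) \<times> real \<Rightarrow> real) \<Rightarrow>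
     (real \<Rightarrow> real^3 \<Rightarrow> real^3) \<Rightarrow> nat \<Rightarrow> ennreal" where
  "weighted_defect \<phi> \<sigma> p w u k =
     ennreal (radius k / (\<sigma> * radius k)\<^sup>2) *
     (\<integral>\<^sup>+(x, t). ennreal (w (x, t)) * increment_defect \<phi> (\<sigma> * radius k) p u x t ^ 4 \<partial>lborel)"

definition S_tilde ::
    "(real^3 \<Rightarrow> real) \<Rightarrow> ((real^3) \<times> real \<Rightarrow> real) \<Rightarrow> real^3 \<Rightarrow> real \<Rightarrow> real \<Rightarrow> real \<Rightarrow>
     (real \<Rightarrow> real^3 \<Rightarrow> real^3) \<Rightarrow> nat \<Rightarrow> ennreal" where
  "S_tilde \<phi> \<theta> x0 t0 \<sigma> p u k = weighted_defect \<phi> \<sigma> p (cutoff \<theta> x0 t0 k) u k"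

definition S_tilde_shell ::
    "(real^3 \<Rightarrow> real) \<Rightarrow> ((real^3) \<times> real \<Rightarrow> real) \<Rightarrow> real^3 \<Rightarrow> real \<Rightarrow> real \<Rightarrow> real \<Rightarrow>
     (real \<Rightarrow> real^3 \<Rightarrow> real^3) \<Rightarrow> nat \<Rightarrow> ennreal" where
  "S_tilde_shell \<phi> \<theta> x0 t0 \<sigma> p u k = weighted_defect \<phi> \<sigma> p (indicator (shell \<theta> x0 t0 k)) u k"


section \<open>Commutator flux, palinstrophy and shell terms\<close>

text \<open>
  The integrals of nonnegative functions take values in \<^typ>\<open>ennreal\<close>.
\<close>

definition F_com ::
    "(real^3 \<Rightarrow> real) \<Rightarrow> ((real^3) \<times> real \<Rightarrow> real) \<Rightarrow> real^3 \<Rightarrow> real \<Rightarrow> real \<Rightarrow>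
     (real \<Rightarrow> real^3 \<Rightarrow> real^3) \<Rightarrow> nat \<Rightarrow> real" where
  "F_com \<phi> \<theta> x0 t0 \<sigma> u k = (let l = \<sigma> * radius k in
     radius k * \<bar>set_lebesgue_integral lborel (cylinder x0 t0 k) (\<lambda>(x, t).
       cutoff \<theta> x0 t0 k (x, t) *
       (vorticity \<phi> l u t x \<bullet> curl (tensor_divergence (stress \<phi> l u t)) x))\<bar>)"

definition P_pal ::
    "(real^3 \<Rightarrow> real) \<Rightarrow> ((real^3) \<times> real \<Rightarrow> real) \<Rightarrow> real^3 \<Rightarrow> real \<Rightarrow> real \<Rightarrow>
     (real \<Rightarrow> real^3 \<Rightarrow> real^3) \<Rightarrow> nat \<Rightarrow> ennreal" where
  "P_pal \<phi> \<theta> x0 t0 \<sigma> u k =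
     ennreal (radius k) * (\<integral>\<^sup>+(x, t) \<in> cylinder x0 t0 k.
       ennreal (cutoff \<theta> x0 t0 k (x, t) *
         (norm (jacobian (vorticity \<phi> (\<sigma> * radius k) u t) (at x)))\<^sup>2) \<partial>lborel)"

definition shell_vorticity ::
    "(real^3 \<Rightarrow> real) \<Rightarrow> ((real^3) \<times> real \<Rightarrow> real) \<Rightarrow> real^3 \<Rightarrow> real \<Rightarrow> real \<Rightarrow>
     (real \<Rightarrow> real^3 \<Rightarrow> real^3) \<Rightarrow> nat \<Rightarrow> ennreal" where
  "shell_vorticity \<phi> \<theta> x0 t0 \<sigma> u k =
     (\<integral>\<^sup>+(x, t) \<in> shell \<theta> x0 t0 k.
       ennreal ((norm (vorticity \<phi> (\<sigma> * radius k) u t x))\<^sup>2) \<partial>lborel)"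

definition shell_stress ::
    "(real^3 \<Rightarrow> real) \<Rightarrow> ((real^3) \<times> real \<Rightarrow> real) \<Rightarrow> real^3 \<Rightarrow> real \<Rightarrow> real \<Rightarrow>
     (real \<Rightarrow> real^3 \<Rightarrow> real^3) \<Rightarrow> nat \<Rightarrow> ennreal" where
  "shell_stress \<phi> \<theta> x0 t0 \<sigma> u k =
     (\<integral>\<^sup>+(x, t) \<in> shell \<theta> x0 t0 k.
       ennreal ((norm (tensor_divergence (stress \<phi> (\<sigma> * radius k) u t) x))\<^sup>2) \<partial>lborel)"

definition L_inc ::
    "real \<Rightarrow> (real^3 \<Rightarrow> real) \<Rightarrow> ((real^3) \<times> real \<Rightarrow> real) \<Rightarrow> real^3 \<Rightarrow> real \<Rightarrow> real \<Rightarrow>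
     (real \<Rightarrow> real^3 \<Rightarrow> real^3) \<Rightarrow> nat \<Rightarrow> ennreal" where
  "L_inc C \<phi> \<theta> x0 t0 \<sigma> u k =
     ennreal (C / radius k) * shell_vorticity \<phi> \<theta> x0 t0 \<sigma> u k
   + ennreal (C * radius k) * shell_stress \<phi> \<theta> x0 t0 \<sigma> u k"

end

theory Submission
  imports Defs
begin

text \<open>
  Since \<open>\<integral> \<nabla>\<phi>\<^sub>l = 0\<close>, the divergence of the stress is an expression in increments: with
  \<open>\<delta> = \<delta>\<^sub>z u\<close>, \<open>w = U - u\<close> and \<open>g = \<nabla>\<phi>\<^sub>l(z)\<close> it is the integral over \<open>z\<close> of
  \<open>(g \<bullet> \<delta>) \<delta> - (g \<bullet> \<delta>) w - (g \<bullet> w) \<delta>\<close>. As \<open>w\<close> is itself the \<open>\<phi>\<^sub>l\<close>-mean of \<open>\<delta>\<close>, Jensen's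
  inequality bounds its norm by \<open>(\<parallel>\<nabla>\<phi>\<parallel>\<^sub>1 / l) M\<^sup>2\<close>, \<open>M\<close> being the increment defect. In the flux the
  outer curl is moved onto \<open>\<chi> \<Omega>\<close> at each fixed time; Young's inequality and
  \<open>|curl \<Omega>|\<^sup>2 \<le> 2 |\<nabla>\<Omega>|\<^sup>2\<close> absorb \<open>\<chi> curl \<Omega>\<close> into the palinstrophy, and the term with \<open>\<nabla>\<chi>\<close>
  lives on the shell.
\<close>

section \<open>Scalar calculus\<close>

text \<open>Derivatives are taken in space only, at a fixed time, and always fall on the kernel: the
  filtered field, its vorticity and the stress divergence are polynomials in convolutions of
  \<open>u\<close> or \<open>u \<otimes> u\<close> with derivatives of the rescaled filter. So the
  slices are C^1 however rough \<open>u\<close> is, and joint measurability in space and time,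
  needed to return from slices to space-time, reduces to measurability of parameter integrals. The
  class \<open>C1\<close> carries the gradient explicitly so that sums, products and convolutions
  stay in it one derivative at a time. The curl of the stress divergence is never expanded: it has
  to exist, and integration by parts removes it.

  The defect may be infinite, so the estimates live in \<open>ennreal\<close>. The universal
  constant comes out as 1: the bound B^2 + 2AB \<le> (A+B)^2 costs nothing, and Young's weight
  \<eta>/2 cancels the 2 in |curl \<Omega>|^2 \<le> 2|\<nabla>\<Omega>|^2, leaving 1/(2\<eta>) in
  front of the squared stress divergence.\<close>

definition C1 :: "(real^3 \<Rightarrow> real) \<Rightarrow> bool" where
  "C1 f \<longleftrightarrow> (\<forall>x. (f has_derivative (\<lambda>h. grad f x \<bullet> h)) (at x)) \<and> continuous_on UNIV (grad f)"

text \<open>On Euclidean space this is compactness of the support, phrased without a closure so that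
  it passes to products, components and gradients by a pointwise argument.\<close>

definition bounded_support :: "('a::real_normed_vector \<Rightarrow> 'b::zero) \<Rightarrow> bool" where
  "bounded_support f \<longleftrightarrow> (\<exists>r. \<forall>x. r < norm x \<longrightarrow> f x = 0)"

lemma inner_axis_sum: "(\<Sum>j\<in>UNIV. h $ j *\<^sub>R axis j (1::real)) = (h::real^'n)"
  by (simp add: vec_eq_iff axis_def if_distrib cong: if_cong)

lemma linear_eq_inner_axis:
  fixes L :: "real^'n \<Rightarrow> real"
  assumes "linear L"
  shows "L h = (\<chi> j. L (axis j 1)) \<bullet> h"
proof -
  have "L h = L (\<Sum>j\<in>UNIV. h $ j *\<^sub>R axis j 1)"
    by (simp add: inner_axis_sum)
  also have "\<dots> = (\<Sum>j\<in>UNIV. h $ j * L (axis j 1))"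
    by (simp add: linear_sum[OF assms] linear_scale[OF assms])
  finally show ?thesis by (simp add: inner_vec_def mult.commute)
qed

lemma differentiable_grad:
  assumes "f differentiable (at x)"
  shows "(f has_derivative (\<lambda>h. grad f x \<bullet> h)) (at x)"
proof -
  have d: "(f has_derivative frechet_derivative f (at x)) (at x)"
    using assms by (simp add: frechet_derivative_works)
  have "frechet_derivative f (at x) = (\<lambda>h. grad f x \<bullet> h)"
    unfolding grad_def by (intro ext linear_eq_inner_axis has_derivative_linear[OF d])
  with d show ?thesis by simp
qed

lemma grad_eqI:
  assumes "(f has_derivative (\<lambda>h. g \<bullet> h)) (at x)"
  shows "grad f x = g"
  using frechet_derivative_at[OF assms, symmetric]
  by (simp add: grad_def vec_eq_iff inner_axis)

lemma C1I:
  assumes "\<And>x. (f has_derivative (\<lambda>h. g x \<bullet> h)) (at x)" "continuous_on UNIV g"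
  shows "C1 f" "grad f = g"
proof -
  show "grad f = g" using grad_eqI[OF assms(1)] by blast
  then show "C1 f" using assms by (simp add: C1_def)
qed

lemma C1_has_derivative:
  "C1 f \<Longrightarrow> (f has_derivative (\<lambda>h. grad f x \<bullet> h)) (at x)"
  by (simp add: C1_def)

lemma C1_differentiable: "C1 f \<Longrightarrow> f differentiable (at x)"
  using C1_has_derivative differentiableI by blast

lemma C1_continuous_grad: "C1 f \<Longrightarrow> continuous_on UNIV (grad f)"
  by (simp add: C1_def)

lemma C1_continuous: "C1 f \<Longrightarrow> continuous_on UNIV f"
  by (meson C1_has_derivative continuous_at_imp_continuous_on has_derivative_continuous)

lemma C1_add:
  assumes "C1 f" "C1 g"
  shows "C1 (\<lambda>x. f x + g x)"
proof (rule C1I(1))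
  show "((\<lambda>x. f x + g x) has_derivative (\<lambda>h. (grad f x + grad g x) \<bullet> h)) (at x)" for x
    unfolding inner_add_left by (intro has_derivative_add C1_has_derivative assms)
  show "continuous_on UNIV (\<lambda>x. grad f x + grad g x)"
    by (intro continuous_intros C1_continuous_grad assms)
qed

lemma
  assumes "C1 f" "C1 g"
  shows C1_diff: "C1 (\<lambda>x. f x - g x)"
    and grad_diff: "grad (\<lambda>x. f x - g x) x = grad f x - grad g x"
proof -
  have "((\<lambda>x. f x - g x) has_derivative (\<lambda>h. (grad f x - grad g x) \<bullet> h)) (at x)" for x
    unfolding inner_diff_left by (intro has_derivative_diff C1_has_derivative assms)
  note C1I[OF this, rule_format]
  moreover have "continuous_on UNIV (\<lambda>x. grad f x - grad g x)"
    by (intro continuous_intros C1_continuous_grad assms)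
  ultimately show "C1 (\<lambda>x. f x - g x)" "grad (\<lambda>x. f x - g x) x = grad f x - grad g x"
    by simp_all
qed

lemma
  assumes "C1 f" "C1 g"
  shows C1_mult: "C1 (\<lambda>x. f x * g x)"
    and grad_mult: "grad (\<lambda>x. f x * g x) x = f x *\<^sub>R grad g x + g x *\<^sub>R grad f x"
proof -
  have "((\<lambda>x. f x * g x) has_derivative (\<lambda>h. (f x *\<^sub>R grad g x + g x *\<^sub>R grad f x) \<bullet> h)) (at x)" for x
    using has_derivative_mult[OF C1_has_derivative[OF assms(1)] C1_has_derivative[OF assms(2)], of x]
    by (simp add: inner_add_left mult.commute)
  note C1I[OF this, rule_format]
  moreover have "continuous_on UNIV (\<lambda>x. f x *\<^sub>R grad g x + g x *\<^sub>R grad f x)"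
    by (intro continuous_intros C1_continuous_grad C1_continuous assms)
  ultimately show "C1 (\<lambda>x. f x * g x)"
    "grad (\<lambda>x. f x * g x) x = f x *\<^sub>R grad g x + g x *\<^sub>R grad f x"
    by simp_all
qed

lemma C1_sum:
  assumes "finite S" "\<And>i. i \<in> S \<Longrightarrow> C1 (f i)"
  shows "C1 (\<lambda>x. \<Sum>i\<in>S. f i x)"
  using assms
proof (induction S)
  case empty
  have "C1 (\<lambda>x. 0)" by (rule C1I[of _ "\<lambda>_. 0"]) auto
  then show ?case by simp
next
  case (insert i S)
  then show ?case by (simp add: C1_add)
qed

text \<open>\<open>jacobian\<close> is read off from the derivative of the whole field. In finite
  dimension differentiable components provide that derivative, and its rows are then the gradients
  of the components.\<close>

lemma jacobian_nth:
  assumes "\<And>i. (\<lambda>y. F y $ i) differentiable (at x)"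
  shows "jacobian F (at x) $ i $ j = grad (\<lambda>y. F y $ i) x $ j"
proof -
  have "F differentiable (at x)"
    using assms by (simp add: differentiable_componentwise_within[of F] Basis_vec_def inner_axis)
  then have d: "(F has_derivative frechet_derivative F (at x)) (at x)"
    by (simp add: frechet_derivative_works)
  then have "((\<lambda>y. F y $ i) has_derivative (\<lambda>h. frechet_derivative F (at x) h $ i)) (at x)"
    by (rule bounded_linear.has_derivative[OF bounded_linear_vec_nth])
  from frechet_derivative_at[OF this, symmetric] show ?thesis
    by (simp add: jacobian_def matrix_def grad_def)
qed

lemma jacobian_nth_C1:
  assumes "\<And>i. C1 (\<lambda>y. F y $ i)"
  shows "jacobian F (at x) $ i $ j = grad (\<lambda>y. F y $ i) x $ j"
  by (intro jacobian_nth C1_differentiable assms)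

subsection \<open>Smooth functions\<close>

lemma smooth_frechet_derivative:
  "smooth f \<Longrightarrow> smooth (\<lambda>x. frechet_derivative f (at x) v)"
  unfolding smooth_def by (metis times_continuously_differentiable.simps(2))

lemma smooth_continuous: "smooth f \<Longrightarrow> continuous_on UNIV f"
  unfolding smooth_def by (metis times_continuously_differentiable.simps(1))

lemma smooth_differentiable: "smooth f \<Longrightarrow> f differentiable (at x)"
  unfolding smooth_def by (metis times_continuously_differentiable.simps(2))

lemma smooth_grad_nth: "smooth f \<Longrightarrow> smooth (\<lambda>x. grad f x $ j)"
  by (simp add: grad_def smooth_frechet_derivative)

lemma smooth_C1:
  assumes "smooth f" shows "C1 f"
proof -
  have "continuous_on UNIV (grad f)"
    unfolding continuous_on_componentwise[of _ "grad f"]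
    by (auto simp: Basis_vec_def inner_axis intro!: smooth_continuous smooth_grad_nth assms)
  then show ?thesis
    by (simp add: C1_def differentiable_grad smooth_differentiable assms)
qed

text \<open>The directional derivative of c f(a x) is (c a) (D_v f)(a x), again of the same shape
  with another prefactor and another function; hence \<open>c\<close> and \<open>f\<close> vary in
  the induction on the order.\<close>

lemma times_continuously_differentiable_scaled:
  fixes f :: "'a::euclidean_space \<Rightarrow> real"
  assumes "times_continuously_differentiable n f"
  shows "times_continuously_differentiable n (\<lambda>x. c * f (a *\<^sub>R x))"
  using assms
proof (induction n arbitrary: f c)
  case 0
  then show ?case
    by (auto intro!: continuous_intros elim!: continuous_on_compose2)
next
  case (Suc n)
  have d: "((\<lambda>x. c * f (a *\<^sub>R x)) has_derivative
      (\<lambda>h. c * frechet_derivative f (at (a *\<^sub>R x)) (a *\<^sub>R h))) (at x)" for x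
  proof -
    have "(f has_derivative frechet_derivative f (at (a *\<^sub>R x))) (at (a *\<^sub>R x))"
      using Suc.prems by (simp add: frechet_derivative_works)
    from has_derivative_compose[of "\<lambda>x. a *\<^sub>R x" "\<lambda>h. a *\<^sub>R h" x UNIV, OF _ this]
    have "((\<lambda>x. f (a *\<^sub>R x)) has_derivative
        (\<lambda>h. frechet_derivative f (at (a *\<^sub>R x)) (a *\<^sub>R h))) (at x)"
      by (simp add: bounded_linear_imp_has_derivative bounded_linear_scaleR_right)
    then show ?thesis by (rule has_derivative_mult_right)
  qed
  have lin: "frechet_derivative f (at (a *\<^sub>R x)) (a *\<^sub>R v)
      = a * frechet_derivative f (at (a *\<^sub>R x)) v" for x v
    using Suc.prems linear_frechet_derivative[of f] by (auto simp: linear_scale)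
  have eq: "frechet_derivative (\<lambda>x. c * f (a *\<^sub>R x)) (at x) v
      = (c * a) * frechet_derivative f (at (a *\<^sub>R x)) v" for x v
    using frechet_derivative_at[OF d[of x], symmetric] by (simp add: lin mult.assoc)
  show ?case
    unfolding times_continuously_differentiable.simps eq
  proof (intro conjI allI)
    show "(\<lambda>x. c * f (a *\<^sub>R x)) differentiable at x" for x
      using d by (rule differentiableI)
    show "times_continuously_differentiable n
        (\<lambda>x. (c * a) * frechet_derivative f (at (a *\<^sub>R x)) v)" for v
      by (rule Suc.IH) (use Suc.prems in simp)
  qed
qed

lemma smooth_scaled:
  fixes f :: "'a::euclidean_space \<Rightarrow> real"
  shows "smooth f \<Longrightarrow> smooth (\<lambda>x. c * f (a *\<^sub>R x))"
  by (simp add: smooth_def times_continuously_differentiable_scaled)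

subsection \<open>Compact supports\<close>

lemma zero_outside_supp: "x \<notin> supp f \<Longrightarrow> f x = 0"
  using closure_subset[of "{x. f x \<noteq> 0}"] by (auto simp: supp_def)

lemma compact_supp_bounded_support:
  assumes "compact (supp f)" shows "bounded_support f"
proof -
  obtain r where "\<And>x. x \<in> supp f \<Longrightarrow> norm x \<le> r"
    using compact_imp_bounded[OF assms] by (auto simp: bounded_iff)
  then have "f x = 0" if "r < norm x" for x
    using that by (intro zero_outside_supp) (auto simp: not_le[symmetric])
  then show ?thesis by (auto simp: bounded_support_def)
qed

lemma bounded_support_grad:
  assumes "bounded_support f"
  shows "bounded_support (grad f)"
proof -
  obtain r where r: "\<And>x. r < norm x \<Longrightarrow> f x = 0"
    using assms by (auto simp: bounded_support_def)
  have "grad f x = 0" if "r < norm x" for x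
  proof (rule grad_eqI)
    have o: "open {x::real^3. r < norm x}" by (intro open_Collect_less continuous_intros)
    have z: "((\<lambda>_. 0) has_derivative (\<lambda>h. 0 \<bullet> h)) (at x)" by simp
    show "(f has_derivative (\<lambda>h. 0 \<bullet> h)) (at x)"
      by (rule has_derivative_transform_within_open[OF z o]) (use r that in simp_all)
  qed
  then show ?thesis by (auto simp: bounded_support_def)
qed

lemma bounded_support_nth: "bounded_support f \<Longrightarrow> bounded_support (\<lambda>x. f x $ j)"
  unfolding bounded_support_def by (metis zero_index)

lemma bounded_support_mult:
  fixes f :: "_ \<Rightarrow> _::mult_zero"
  shows "bounded_support f \<Longrightarrow> bounded_support (\<lambda>x. f x * g x)"
  unfolding bounded_support_def by (metis mult_zero_left)

lemma continuous_bounded_support_bound: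
  fixes f :: "'a::euclidean_space \<Rightarrow> 'b::real_normed_vector"
  assumes "continuous_on UNIV f" "bounded_support f"
  obtains B where "0 < B" "\<And>x. norm (f x) \<le> B"
proof -
  obtain r where r: "\<And>x. r < norm x \<Longrightarrow> f x = 0"
    using assms by (auto simp: bounded_support_def)
  have "bounded (f ` cball 0 r)"
    by (intro compact_imp_bounded compact_continuous_image continuous_on_subset[OF assms(1)]) auto
  then obtain B where "0 < B" "\<And>x. x \<in> cball 0 r \<Longrightarrow> norm (f x) \<le> B"
    by (auto simp: bounded_pos)
  with r show ?thesis by (intro that[of B]) (metis less_eq_real_def mem_cball_0 norm_zero not_le)+
qed

lemma continuous_bounded_support_uniform:
  fixes f :: "'a::euclidean_space \<Rightarrow> 'b::real_normed_vector"
  assumes "continuous_on UNIV f" "bounded_support f" "0 < e"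
  obtains d where "0 < d" "\<And>x y. norm (x - y) < d \<Longrightarrow> norm (f x - f y) < e"
proof -
  obtain r where r: "\<And>x. r < norm x \<Longrightarrow> f x = 0"
    using assms by (auto simp: bounded_support_def)
  \<comment> \<open>The margin of one covers the boundary: if two points are at distance less than
    one and one of them leaves this ball, both are outside the ball of radius \<open>r\<close>,
    where \<open>f\<close> vanishes.\<close>
  have "uniformly_continuous_on (cball 0 (r + 1)) f"
    by (intro compact_uniformly_continuous continuous_on_subset[OF assms(1)]) auto
  then obtain d where d: "0 < d"
    "\<And>x y. x \<in> cball 0 (r + 1) \<Longrightarrow> y \<in> cball 0 (r + 1) \<Longrightarrow> dist y x < d \<Longrightarrow> dist (f y) (f x) < e"
    using \<open>0 < e\<close> unfolding uniformly_continuous_on_def by metis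
  have "norm (f x - f y) < e" if xy: "norm (x - y) < min d 1" for x y
  proof (cases "norm x \<le> r + 1 \<and> norm y \<le> r + 1")
    case True
    with d(2)[of y x] xy show ?thesis by (simp add: dist_norm)
  next
    case False
    then have "r < norm x" "r < norm y"
      using xy norm_triangle_ineq2[of x y] norm_triangle_ineq2[of y x]
      by (auto simp: norm_minus_commute)
    with r \<open>0 < e\<close> show ?thesis by simp
  qed
  with d(1) show ?thesis by (intro that[of "min d 1"]) auto
qed

section \<open>Convolution with compactly supported kernels\<close>

text \<open>A common class for everything that gets convolved: the slices of \<open>u\<close>, known
  to be square integrable, the products of their components, known to be integrable, and
  constants.\<close>

definition locally_integrable :: "('a::euclidean_space \<Rightarrow> 'b::euclidean_space) \<Rightarrow> bool" where
  "locally_integrable f \<longleftrightarrow>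
     f \<in> borel_measurable borel \<and> (\<forall>r. set_integrable lborel (cball 0 r) f)"

lemma locally_integrable_nth:
  fixes f :: "'a::euclidean_space \<Rightarrow> 'b::euclidean_space^'n"
  assumes "locally_integrable f" shows "locally_integrable (\<lambda>x. f x $ i)"
proof -
  have [measurable]: "f \<in> borel_measurable borel"
    and int: "integrable lborel (\<lambda>x. indicator (cball 0 r) x *\<^sub>R f x)" for r
    using assms by (auto simp: locally_integrable_def set_integrable_def)
  have "(\<lambda>x. f x $ i) \<in> borel_measurable borel"
    by (rule borel_measurable_continuous_on[OF _ \<open>f \<in> borel_measurable borel\<close>])
      (intro continuous_intros)
  then show ?thesis
    using integrable_bounded_linear[OF bounded_linear_vec_nth[of i] int]
    by (simp add: locally_integrable_def set_integrable_def)
qed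
 
lemma lborel_reflect:
  fixes x :: "'a::euclidean_space"
  shows "distr lborel borel (\<lambda>z. x - z) = lborel"
  using lborel_affine[of "-1" x] by (simp add: density_1)

lemma
  fixes g :: "'a::euclidean_space \<Rightarrow> 'b::euclidean_space"
  assumes [measurable]: "g \<in> borel_measurable borel"
  shows integrable_reflect: "integrable lborel (\<lambda>z. g (x - z)) \<longleftrightarrow> integrable lborel g"
    and integral_reflect: "(LINT z|lborel. g (x - z)) = (LINT z|lborel. g z)"
proof -
  have m: "(\<lambda>z. x - z) \<in> borel_measurable lborel" by simp
  show "integrable lborel (\<lambda>z. g (x - z)) \<longleftrightarrow> integrable lborel g"
    using integrable_distr_eq[OF m, of g] by (simp add: lborel_reflect)
  show "(LINT z|lborel. g (x - z)) = (LINT z|lborel. g z)"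
    using integral_distr[OF m, of g] by (simp add: lborel_reflect)
qed

lemma integrable_mult_locally_integrable:
  fixes \<psi> :: "'a::euclidean_space \<Rightarrow> real"
  assumes "continuous_on UNIV \<psi>" "bounded_support \<psi>" "locally_integrable f"
  shows "integrable lborel (\<lambda>y. \<psi> (x - y) *\<^sub>R f y)"
proof -
  obtain B where B: "0 < B" "\<And>x. norm (\<psi> x) \<le> B"
    using continuous_bounded_support_bound[OF assms(1,2)] by blast
  obtain r where r: "\<And>x. r < norm x \<Longrightarrow> \<psi> x = 0"
    using assms by (auto simp: bounded_support_def)
  have [measurable]: "f \<in> borel_measurable borel" "\<psi> \<in> borel_measurable borel"
    using assms by (auto simp: locally_integrable_def intro: borel_measurable_continuous_onI)
  have "integrable lborel (\<lambda>y. B *\<^sub>R (indicator (cball 0 (norm x + r)) y *\<^sub>R f y))"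
    using assms(3) by (intro integrable_scaleR_right) (auto simp: locally_integrable_def set_integrable_def)
  then show ?thesis
  proof (rule Bochner_Integration.integrable_bound)
    show "AE y in lborel. norm (\<psi> (x - y) *\<^sub>R f y)
        \<le> norm (B *\<^sub>R (indicator (cball 0 (norm x + r)) y *\<^sub>R f y))"
    proof (intro AE_I2)
      fix y
      show "norm (\<psi> (x - y) *\<^sub>R f y) \<le> norm (B *\<^sub>R (indicator (cball 0 (norm x + r)) y *\<^sub>R f y))"
      proof (cases "norm y \<le> norm x + r")
        case True
        then show ?thesis using B(1) B(2)[of "x - y"] by (auto intro!: mult_right_mono)
      next
        case False
        then have "r < norm (x - y)"
          using norm_triangle_ineq3[of x y] by linarith
        then show ?thesis by (simp add: r)
      qed
    qed
  qed measurable
qed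

text \<open>Reflection moves the point \<open>x\<close> from the rough factor \<open>f\<close> to
  the kernel, which is the factor that can be differentiated.\<close>

lemma
  fixes \<psi> :: "real^3 \<Rightarrow> real"
  assumes "continuous_on UNIV \<psi>" "bounded_support \<psi>" "locally_integrable f"
  shows convolution_integrable: "integrable lborel (\<lambda>z. \<psi> z *\<^sub>R f (x - z))"
    and convolution_reflect: "convolution \<psi> f x = (LINT y|lborel. \<psi> (x - y) *\<^sub>R f y)"
proof -
  have [measurable]: "f \<in> borel_measurable borel" "\<psi> \<in> borel_measurable borel"
    using assms by (auto simp: locally_integrable_def intro: borel_measurable_continuous_onI)
  have m: "(\<lambda>y. \<psi> (x - y) *\<^sub>R f y) \<in> borel_measurable borel" by measurable
  show "integrable lborel (\<lambda>z. \<psi> z *\<^sub>R f (x - z))"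
    using integrable_mult_locally_integrable[OF assms] integrable_reflect[OF m, of x] by simp
  show "convolution \<psi> f x = (LINT y|lborel. \<psi> (x - y) *\<^sub>R f y)"
    using integral_reflect[OF m, of x] by (simp add: convolution_def)
qed

lemma convolution_nth:
  fixes f :: "real^3 \<Rightarrow> 'b::euclidean_space^'n"
  assumes "continuous_on UNIV \<psi>" "bounded_support \<psi>" "locally_integrable f"
  shows "convolution \<psi> f x $ i = convolution \<psi> (\<lambda>y. f y $ i) x"
  unfolding convolution_def
  using integral_bounded_linear[OF bounded_linear_vec_nth[of i] convolution_integrable[OF assms, of x]]
  by simp

text \<open>The difference quotient acts on the kernel alone. Its Taylor remainder is o(|h|)
  uniformly in the base point, because the gradient of a compactly supported C^1 function is
  uniformly continuous; integrating it against \<open>f\<close> over one fixed ball keeps it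
  o(|h|).\<close>

proposition convolution_has_derivative:
  fixes \<psi> f :: "real^3 \<Rightarrow> real"
  assumes \<psi>: "C1 \<psi>" "bounded_support \<psi>" and f: "locally_integrable f"
  shows "(convolution \<psi> f has_derivative
           (\<lambda>h. (\<chi> j. convolution (\<lambda>z. grad \<psi> z $ j) f x) \<bullet> h)) (at x)"
proof -
  note cont = C1_continuous[OF \<psi>(1)] and gcont = C1_continuous_grad[OF \<psi>(1)]
  note gsupp = bounded_support_grad[OF \<psi>(2)]
  have gc: "continuous_on UNIV (\<lambda>z. grad \<psi> z $ j)" for j
    by (intro continuous_intros gcont)
  note intg = integrable_mult_locally_integrable[OF gc bounded_support_nth[OF gsupp] f]
  note int\<psi> = integrable_mult_locally_integrable[OF cont \<psi>(2) f]
  obtain r where r: "\<And>x. r < norm x \<Longrightarrow> \<psi> x = 0" "\<And>x. r < norm x \<Longrightarrow> grad \<psi> x = 0"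
    using \<psi>(2) gsupp unfolding bounded_support_def by (metis max_less_iff_conj)
  \<comment> \<open>The mass of |f| on a ball that contains the supports of all shifted kernels
    \<psi>(w - y) with |w - x| < 1.\<close>
  define K where "K = (LINT y|lborel. indicator (cball 0 (norm x + r + 1)) y * \<bar>f y\<bar>)"
  have fint: "integrable lborel (\<lambda>y. indicator (cball 0 (norm x + r + 1)) y * f y)"
    using f by (auto simp: locally_integrable_def set_integrable_def)
  then have Kint: "integrable lborel (\<lambda>y. indicator (cball 0 (norm x + r + 1)) y * \<bar>f y\<bar>)"
    by (auto dest: integrable_abs simp: abs_mult)
  have K: "0 \<le> K" unfolding K_def by (intro integral_nonneg_AE) auto
  let ?L = "\<lambda>h. (\<chi> j. convolution (\<lambda>z. grad \<psi> z $ j) f x) \<bullet> h"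
  have L: "?L h = (LINT y|lborel. (grad \<psi> (x - y) \<bullet> h) * f y)"
    and Lint: "integrable lborel (\<lambda>y. (grad \<psi> (x - y) \<bullet> h) * f y)" for h
  proof -
    have i: "integrable lborel (\<lambda>y. (grad \<psi> (x - y) $ j * f y) * h $ j)" for j
      using intg[of x j] by (intro integrable_mult_left) simp
    have eq: "(\<lambda>y. (grad \<psi> (x - y) \<bullet> h) * f y) = (\<lambda>y. \<Sum>j\<in>UNIV. (grad \<psi> (x - y) $ j * f y) * h $ j)"
      by (simp only: inner_vec_def inner_real_def sum_distrib_right) (simp only: mult_ac)
    show "integrable lborel (\<lambda>y. (grad \<psi> (x - y) \<bullet> h) * f y)"
      unfolding eq by (rule Bochner_Integration.integrable_sum) (rule i)
    show "?L h = (LINT y|lborel. (grad \<psi> (x - y) \<bullet> h) * f y)"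
    proof -
      have "?L h = (\<Sum>j\<in>UNIV. convolution (\<lambda>z. grad \<psi> z $ j) f x * h $ j)"
        by (simp add: inner_vec_def)
      also have "\<dots> = (\<Sum>j\<in>UNIV. (LINT y|lborel. (grad \<psi> (x - y) $ j * f y) * h $ j))"
        by (intro sum.cong refl)
          (simp only: convolution_reflect[OF gc bounded_support_nth[OF gsupp] f] integral_mult_left_zero real_scaleR_def)
      also have "\<dots> = (LINT y|lborel. (grad \<psi> (x - y) \<bullet> h) * f y)"
        unfolding eq by (rule Bochner_Integration.integral_sum[symmetric]) (rule i)
      finally show ?thesis .
    qed
  qed
  show ?thesis
    unfolding has_derivative_at_alt
  proof (intro conjI allI impI)
    show "bounded_linear ?L" by (rule bounded_linear_inner_right)
    fix e :: real assume e: "0 < e"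
    \<comment> \<open>Dividing by \<open>K + 1\<close> instead of \<open>K\<close> since
      \<open>K\<close> is zero when \<open>f\<close> vanishes on the ball.\<close>
    define e' where "e' = e / (K + 1)"
    have e': "0 < e'" using e K by (simp add: e'_def)
    obtain d where d: "0 < d" "\<And>x y. norm (x - y) < d \<Longrightarrow> norm (grad \<psi> x - grad \<psi> y) < e'"
      using continuous_bounded_support_uniform[OF gcont gsupp e'] by blast
    have taylor: "\<bar>\<psi> (z + h) - \<psi> z - grad \<psi> z \<bullet> h\<bar> \<le> norm h * e'" if "norm h < d" for z h
    proof -
      have "norm (\<psi> (z + h) - \<psi> z - grad \<psi> z \<bullet> (z + h - z)) \<le> norm (z + h - z) * e'"
      proof (rule differentiable_bound_linearization[where S = "ball z d"
            and f' = "\<lambda>x h. grad \<psi> x \<bullet> h"])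
        show "z + t *\<^sub>R (z + h - z) \<in> ball z d" if "t \<in> {0..1}" for t
          using that \<open>norm h < d\<close> mult_left_le_one_le[of "norm h" t] by (auto simp: dist_norm)
        show "(\<psi> has_derivative (\<lambda>h. grad \<psi> y \<bullet> h)) (at y within ball z d)" for y
          by (rule has_derivative_at_withinI[OF C1_has_derivative[OF \<psi>(1)]])
        show "onorm ((\<lambda>h. grad \<psi> y \<bullet> h) - (\<lambda>h. grad \<psi> z \<bullet> h)) \<le> e'" if "y \<in> ball z d" for y
          unfolding fun_diff_def
        proof (rule onorm_le)
          fix k
          have "norm (grad \<psi> y \<bullet> k - grad \<psi> z \<bullet> k) \<le> norm (grad \<psi> y - grad \<psi> z) * norm k"
            by (metis Cauchy_Schwarz_ineq2 inner_diff_left real_norm_def)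
          also have "\<dots> \<le> e' * norm k"
            using d(2)[of y z] that
            by (intro mult_right_mono) (auto simp: dist_norm norm_minus_commute less_imp_le)
          finally show "norm (grad \<psi> y \<bullet> k - grad \<psi> z \<bullet> k) \<le> e' * norm k" .
        qed
        show "z \<in> ball z d" using d by simp
      qed
      then show ?thesis by simp
    qed
    show "\<exists>d>0. \<forall>y. norm (y - x) < d \<longrightarrow>
        norm (convolution \<psi> f y - convolution \<psi> f x - ?L (y - x)) \<le> e * norm (y - x)"
    proof (intro exI[of _ "min d 1"] conjI allI impI)
      show "0 < min d 1" using d by simp
      fix w assume w: "norm (w - x) < min d 1"
      define h where "h = w - x"
      have h: "norm h < d" "norm h < 1" "w = x + h" using w by (auto simp: h_def)
      have "convolution \<psi> f w - convolution \<psi> f x - ?L h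
          = (LINT y|lborel. (\<psi> (w - y) - \<psi> (x - y) - grad \<psi> (x - y) \<bullet> h) * f y)"
        using int\<psi>[of w] int\<psi>[of x] Lint[of h]
        by (simp add: L convolution_reflect[OF cont \<psi>(2) f] left_diff_distrib)
      also have "norm \<dots> \<le> (LINT y|lborel. (norm h * e') *
            (indicator (cball 0 (norm x + r + 1)) y * \<bar>f y\<bar>))"
      proof (rule Bochner_Integration.integral_norm_bound_integral)
        show "integrable lborel (\<lambda>y. (\<psi> (w - y) - \<psi> (x - y) - grad \<psi> (x - y) \<bullet> h) * f y)"
          using int\<psi>[of w] int\<psi>[of x] Lint[of h] by (simp add: left_diff_distrib)
        show "integrable lborel (\<lambda>y. (norm h * e') *
            (indicator (cball 0 (norm x + r + 1)) y * \<bar>f y\<bar>))"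
          using Kint by (rule integrable_mult_right)
        fix y
        show "norm ((\<psi> (w - y) - \<psi> (x - y) - grad \<psi> (x - y) \<bullet> h) * f y)
            \<le> (norm h * e') * (indicator (cball 0 (norm x + r + 1)) y * \<bar>f y\<bar>)"
        proof (cases "norm y \<le> norm x + r + 1")
          case True
          have "x - y + h = w - y" by (simp add: h(3))
          then have "\<bar>\<psi> (w - y) - \<psi> (x - y) - grad \<psi> (x - y) \<bullet> h\<bar> \<le> norm h * e'"
            using taylor[OF h(1), of "x - y"] by (simp only:)
          from mult_right_mono[OF this abs_ge_zero[of "f y"]] True show ?thesis
            by (simp add: abs_mult)
        next
          case False
          have "norm y - norm x \<le> norm (x - y)" using norm_triangle_ineq2[of y x]
            by (simp add: norm_minus_commute)
          moreover have "norm (x - y) - norm h \<le> norm (w - y)"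
            using norm_triangle_ineq2[of "x - y" "- h"] by (simp add: h(3) algebra_simps)
          ultimately have "r < norm (x - y)" "r < norm (w - y)" using False h(2) by linarith+
          then show ?thesis using e' by (simp add: r)
        qed
      qed
      also have "\<dots> = (norm h * e') * K" by (simp add: K_def)
      also have "\<dots> \<le> e * norm h"
      proof -
        have "e' * K \<le> e" using K e by (simp add: e'_def field_simps)
        then show ?thesis using mult_left_mono[of "e' * K" e "norm h"] by (simp add: algebra_simps)
      qed
      finally show "norm (convolution \<psi> f w - convolution \<psi> f x - ?L (w - x)) \<le> e * norm (w - x)"
        by (simp add: h_def)
    qed
  qed
qed

text \<open>Each partial derivative of a smooth kernel is itself an admissible kernel, so the
  partial derivatives of the convolution are differentiable and therefore continuous.\<close>

lemma C1_convolution: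
  assumes "smooth \<psi>" "bounded_support \<psi>" "locally_integrable f"
  shows "C1 (convolution \<psi> f)"
    and "grad (convolution \<psi> f) x $ j = convolution (\<lambda>z. grad \<psi> z $ j) f x"
proof -
  let ?g = "\<lambda>x. \<chi> j. convolution (\<lambda>z. grad \<psi> z $ j) f x"
  have d: "(convolution \<psi> f has_derivative (\<lambda>h. ?g x \<bullet> h)) (at x)" for x
    by (intro convolution_has_derivative smooth_C1 assms)
  have "continuous_on UNIV (convolution (\<lambda>z. grad \<psi> z $ j) f)" for j
  proof (rule continuous_at_imp_continuous_on, rule ballI)
    fix x
    have "C1 (\<lambda>z. grad \<psi> z $ j)" by (intro smooth_C1 smooth_grad_nth assms)
    from convolution_has_derivative[OF this bounded_support_nth[OF bounded_support_grad] assms(3)] assms(2)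
    show "isCont (convolution (\<lambda>z. grad \<psi> z $ j) f) x"
      using has_derivative_continuous by blast
  qed
  then have c: "continuous_on UNIV ?g" by (rule continuous_on_vec_lambda)
  show "C1 (convolution \<psi> f)" by (rule C1I(1)[OF d c])
  show "grad (convolution \<psi> f) x $ j = convolution (\<lambda>z. grad \<psi> z $ j) f x"
    by (simp add: C1I(2)[OF d c])
qed

section \<open>Integrals of compactly supported functions and of their gradients\<close>

lemma locally_integrable_const: "locally_integrable (\<lambda>_. c)"
proof -
  have "integrable lborel (\<lambda>x::'a. indicator (cball 0 r) x *\<^sub>R c)" for r
    using emeasure_lborel_cball_finite[of "0::'a" r] 
    by (intro integrable_scaleR_left integrable_real_indicator) auto
  then show ?thesis by (simp add: locally_integrable_def set_integrable_def)
qed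

lemma integrable_continuous_bounded_support:
  fixes f :: "real^3 \<Rightarrow> real"
  assumes "continuous_on UNIV f" "bounded_support f"
  shows "integrable lborel f"
  using convolution_integrable[OF assms locally_integrable_const[of "1::real"]] by simp

text \<open>The integral of \<open>f\<close> is the constant function \<open>f * 1\<close>, whose gradient is \<open>\<nabla>f * 1\<close>.\<close>

lemma integral_grad_eq_0:
  assumes "C1 f" "bounded_support f"
  shows "(LINT x|lborel. grad f x $ j) = 0"
proof -
  have "((\<lambda>_. LINT z|lborel. f z) has_derivative
      (\<lambda>h. (\<chi> j. LINT z|lborel. grad f z $ j) \<bullet> h)) (at 0)"
    using convolution_has_derivative[OF assms locally_integrable_const[of "1::real"], of 0]
    by (simp add: convolution_def[abs_def])
  from grad_eqI[OF this] grad_eqI[of "\<lambda>_. LINT z|lborel. f z" 0 0]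
  have "(\<chi> j. LINT z|lborel. grad f z $ j) = 0" by simp
  then show ?thesis by (simp add: vec_eq_iff)
qed

section \<open>Integration by parts for the curl\<close>

lemma curl_nth:
  assumes "\<And>i. C1 (\<lambda>y. F y $ i)"
  shows "curl F x $ 1 = grad (\<lambda>y. F y $ 3) x $ 2 - grad (\<lambda>y. F y $ 2) x $ 3"
    and "curl F x $ 2 = grad (\<lambda>y. F y $ 1) x $ 3 - grad (\<lambda>y. F y $ 3) x $ 1"
    and "curl F x $ 3 = grad (\<lambda>y. F y $ 2) x $ 1 - grad (\<lambda>y. F y $ 1) x $ 2"
  by (simp_all add: curl_def Let_def jacobian_nth_C1[OF assms])

lemma continuous_on_vec_nthI:
  assumes "\<And>i. continuous_on S (\<lambda>x. F x $ i)"
  shows "continuous_on S F"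
  using continuous_on_vec_lambda[of S "\<lambda>i x. F x $ i"] assms by simp

lemma continuous_curl:
  assumes "\<And>i. C1 (\<lambda>y. F y $ i)"
  shows "continuous_on UNIV (curl F)"
proof -
  have "continuous_on UNIV (\<lambda>x. curl F x $ 1)" "continuous_on UNIV (\<lambda>x. curl F x $ 2)"
    "continuous_on UNIV (\<lambda>x. curl F x $ 3)"
    unfolding curl_nth[OF assms] by (intro continuous_intros C1_continuous_grad assms)+
  then have "continuous_on UNIV (\<lambda>x. curl F x $ i)" for i
    using exhaust_3[of i] by auto
  then show ?thesis by (rule continuous_on_vec_nthI)
qed

lemma curl_scaled:
  assumes "C1 c" "\<And>i. C1 (\<lambda>y. F y $ i)"
  shows "curl (\<lambda>y. c y *\<^sub>R F y) x = c x *\<^sub>R curl F x + cross3 (grad c x) (F x)"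
proof -
  have "C1 (\<lambda>y. (c y *\<^sub>R F y) $ i)" for i
    by (simp add: C1_mult assms)
  then show ?thesis
    by (simp add: vec_eq_iff forall_3 curl_nth assms cross3_def grad_mult algebra_simps)
qed

lemma norm_cross_le: "norm (cross3 a b) \<le> norm a * norm b"
proof (rule power2_le_imp_le)
  show "(norm (cross3 a b))\<^sup>2 \<le> (norm a * norm b)\<^sup>2"
    by (simp add: norm_cross power_mult_distrib)
qed auto

text \<open>The divergence of \<open>G \<times> F\<close> is \<open>F \<bullet> curl G - G \<bullet> curl F\<close>.\<close>

lemma integral_curl_by_parts:
  assumes F: "\<And>i. C1 (\<lambda>y. F y $ i)" and G: "\<And>i. C1 (\<lambda>y. G y $ i)"
    and supp: "bounded_support F"
  shows "(LINT x|lborel. F x \<bullet> curl G x) = (LINT x|lborel. curl F x \<bullet> G x)"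
    and "integrable lborel (\<lambda>x. curl F x \<bullet> G x)"
proof -
  have cF: "continuous_on UNIV F" and cG: "continuous_on UNIV G"
    by (intro continuous_on_vec_nthI C1_continuous F G)+
  have zero: "bounded_support (\<lambda>y. F y $ i)" for i
    by (rule bounded_support_nth[OF supp])
  have bF: "bounded_support (\<lambda>x. F x \<bullet> curl G x)"
    using supp unfolding bounded_support_def by (metis inner_zero_left)
  have "bounded_support (curl F)"
  proof -
    have "\<exists>r. \<forall>i x. r < norm x \<longrightarrow> grad (\<lambda>y. F y $ i) x = 0"
    proof -
      obtain r where "\<And>i x. r i < norm x \<Longrightarrow> grad (\<lambda>y. F y $ i) x = 0"
        using bounded_support_grad[OF zero] unfolding bounded_support_def by metis
      then have "\<forall>i x. (MAX i. r i) < norm x \<longrightarrow> grad (\<lambda>y. F y $ i) x = 0"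
        by (simp add: Max_less_iff)
      then show ?thesis by blast
    qed
    then obtain r where "\<And>i x. r < norm x \<Longrightarrow> grad (\<lambda>y. F y $ i) x = 0" by blast
    then have "r < norm x \<Longrightarrow> curl F x = 0" for x
      by (simp add: vec_eq_iff forall_3 curl_nth[OF F])
    then show ?thesis unfolding bounded_support_def by blast
  qed
  then have bG: "bounded_support (\<lambda>x. curl F x \<bullet> G x)"
    unfolding bounded_support_def by (metis inner_zero_left)
  have i1: "integrable lborel (\<lambda>x. F x \<bullet> curl G x)"
    by (intro integrable_continuous_bounded_support bF continuous_intros cF continuous_curl G)
  show i2: "integrable lborel (\<lambda>x. curl F x \<bullet> G x)"
    by (intro integrable_continuous_bounded_support bG continuous_intros cG continuous_curl F)
  \<comment> \<open>The components of G \<times> F are differences of these products, so its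
    divergence is a signed sum of six partial derivatives of them, each with vanishing
    integral.\<close>
  define N where "N i j = (\<lambda>y. F y $ i * G y $ j)" for i j
  have N: "C1 (N i j)" "bounded_support (N i j)" for i j
    unfolding N_def by (intro C1_mult F G bounded_support_mult zero)+
  have gN: "grad (N i j) x $ k = F x $ i * grad (\<lambda>y. G y $ j) x $ k
      + G x $ j * grad (\<lambda>y. F y $ i) x $ k" for i j k x
    unfolding N_def by (simp add: grad_mult F G)
  have iN: "integrable lborel (\<lambda>x. grad (N i j) x $ k)" for i j k
    by (intro integrable_continuous_bounded_support continuous_intros C1_continuous_grad
        bounded_support_nth bounded_support_grad N)
  have "(LINT x|lborel. F x \<bullet> curl G x - curl F x \<bullet> G x) =
     (LINT x|lborel. grad (N 3 2) x $ 1 - grad (N 2 3) x $ 1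
       + (grad (N 1 3) x $ 2 - grad (N 3 1) x $ 2)
       + (grad (N 2 1) x $ 3 - grad (N 1 2) x $ 3))"
    by (intro Bochner_Integration.integral_cong refl)
      (simp add: inner_vec_def sum_3 curl_nth F G gN algebra_simps)
  also have "\<dots> = 0"
    by (simp add: iN integral_grad_eq_0[OF N])
  finally show "(LINT x|lborel. F x \<bullet> curl G x) = (LINT x|lborel. curl F x \<bullet> G x)"
    using i1 i2 by simp
qed

text \<open>The cutoff is attached to \<open>F\<close>, which makes the boundary terms disappear for
  any C^1 field \<open>G\<close>. The two contributions of curl(cF) = c curl F + \<nabla>c \<times>
  F stay separate on the right, as Young's inequality will be applied to them with different
  weights.\<close>

lemma integral_cutoff_curl_bound:
  assumes c: "C1 c" "bounded_support c" "\<And>x. 0 \<le> c x"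
    and F: "\<And>i. C1 (\<lambda>y. F y $ i)" and G: "\<And>i. C1 (\<lambda>y. G y $ i)"
  shows "ennreal \<bar>LINT x|lborel. c x * (F x \<bullet> curl G x)\<bar>
    \<le> (\<integral>\<^sup>+x. ennreal (c x * (norm (curl F x) * norm (G x)) + norm (grad c x) * (norm (F x) * norm (G x))) \<partial>lborel)"
proof -
  let ?F = "\<lambda>x. c x *\<^sub>R F x"
  have F': "C1 (\<lambda>y. ?F y $ i)" for i
    by (simp add: C1_mult c F)
  have b: "bounded_support ?F"
    using c(2) unfolding bounded_support_def by (metis scaleR_zero_left)
  have "(LINT x|lborel. c x * (F x \<bullet> curl G x)) = (LINT x|lborel. curl ?F x \<bullet> G x)"
    using integral_curl_by_parts(1)[OF F' G b] by simp
  also have "ennreal \<bar>\<dots>\<bar> \<le> (\<integral>\<^sup>+x. ennreal (norm (curl ?F x \<bullet> G x)) \<partial>lborel)"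
    using integral_norm_bound_ennreal[OF integral_curl_by_parts(2)[OF F' G b]] by simp
  also have "\<dots> \<le> (\<integral>\<^sup>+x. ennreal (c x * (norm (curl F x) * norm (G x))
      + norm (grad c x) * (norm (F x) * norm (G x))) \<partial>lborel)"
  proof (intro nn_integral_mono ennreal_leI)
    fix x
    have "norm (curl ?F x) \<le> c x * norm (curl F x) + norm (grad c x) * norm (F x)"
      unfolding curl_scaled[OF c(1) F]
      using norm_triangle_ineq[of "c x *\<^sub>R curl F x"] norm_cross_le[of "grad c x" "F x"] c(3)[of x]
      by (smt (verit) norm_scaleR)
    moreover have "norm (curl ?F x \<bullet> G x) \<le> norm (curl ?F x) * norm (G x)"
      using Cauchy_Schwarz_ineq2 by simp
    ultimately show "norm (curl ?F x \<bullet> G x) \<le> c x * (norm (curl F x) * norm (G x))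
      + norm (grad c x) * (norm (F x) * norm (G x))"
      by (smt (verit) mult_right_mono norm_ge_zero distrib_right mult.assoc)
  qed
  finally show ?thesis .
qed

section \<open>The filtered field at a fixed time\<close>

lemma locally_integrable_integrable:
  assumes "integrable lborel f"
  shows "locally_integrable f"
  using assms integrable_mult_indicator[of "cball 0 _" lborel f]
  by (auto simp: locally_integrable_def set_integrable_def)

lemma square_integrable_measurable:
  "square_integrable v \<Longrightarrow> v \<in> borel_measurable borel"
  by (simp add: square_integrable_def)

lemma locally_integrable_square_integrable:
  assumes "square_integrable v"
  shows "locally_integrable v"
proof -
  have "integrable lborel (\<lambda>x. indicator (cball 0 r) x *\<^sub>R v x)" for r
  proof (rule Bochner_Integration.integrable_bound)
    show "integrable lborel (\<lambda>x. indicator (cball 0 r) x *\<^sub>R (1::real) + (norm (v x))\<^sup>2)"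
      using assms locally_integrable_const[of "1::real"]
      by (intro Bochner_Integration.integrable_add)
        (auto simp: square_integrable_def locally_integrable_def set_integrable_def)
    have "norm (v x) \<le> 1 + (norm (v x))\<^sup>2" for x
    proof -
      have "0 \<le> (norm (v x) - 1)\<^sup>2" by (rule zero_le_power2)
      then have "2 * norm (v x) \<le> (norm (v x))\<^sup>2 + 1" by (simp add: power2_diff)
      then show ?thesis using norm_ge_zero[of "v x"] by linarith
    qed
    then show "AE x in lborel. norm (indicator (cball 0 r) x *\<^sub>R v x)
        \<le> norm (indicator (cball 0 r) x *\<^sub>R (1::real) + (norm (v x))\<^sup>2)"
      by (intro AE_I2) (simp add: indicator_def)
    show "(\<lambda>x. indicator (cball 0 r) x *\<^sub>R v x) \<in> borel_measurable lborel"
      using square_integrable_measurable[OF assms]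
      by (intro borel_measurable_scaleR borel_measurable_indicator) auto
  qed
  then show ?thesis
    using square_integrable_measurable[OF assms] by (simp add: locally_integrable_def set_integrable_def)
qed

lemma borel_measurable_vec_nth [measurable (raw)]:
  fixes f :: "'a \<Rightarrow> 'b::euclidean_space^'n"
  assumes "f \<in> borel_measurable M"
  shows "(\<lambda>x. f x $ i) \<in> borel_measurable M"
  by (rule borel_measurable_continuous_on[OF _ assms]) (intro continuous_intros)

lemma borel_measurable_vecI:
  fixes f :: "'a \<Rightarrow> 'b::euclidean_space^'n"
  assumes "\<And>i. (\<lambda>x. f x $ i) \<in> borel_measurable M"
  shows "f \<in> borel_measurable M"
  unfolding borel_measurable_euclidean_space[of f]
  by (auto simp: Basis_vec_def inner_axis intro!: borel_measurable_inner assms)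

lemma integrable_vecI:
  fixes f :: "'a \<Rightarrow> real^'n"
  assumes "\<And>i. integrable M (\<lambda>x. f x $ i)"
  shows "integrable M f"
proof -
  have "integrable M (\<lambda>x. \<Sum>i\<in>UNIV. f x $ i *\<^sub>R axis i (1::real))"
    by (rule Bochner_Integration.integrable_sum) (rule integrable_scaleR_left[OF assms])
  then show ?thesis by (simp only: inner_axis_sum)
qed

lemma integrable_mult_nth:
  assumes "square_integrable v"
  shows "integrable lborel (\<lambda>y. v y $ i * v y $ j)"
proof (rule Bochner_Integration.integrable_bound)
  note [measurable] = square_integrable_measurable[OF assms]
  show "integrable lborel (\<lambda>y. (norm (v y))\<^sup>2)"
    using assms by (simp add: square_integrable_def)
  show "(\<lambda>y. v y $ i * v y $ j) \<in> borel_measurable lborel" by measurable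
  show "AE y in lborel. norm (v y $ i * v y $ j) \<le> norm ((norm (v y))\<^sup>2)"
    by (intro AE_I2)
      (auto simp: abs_mult power2_eq_square intro!: mult_mono component_le_norm_cart)
qed

text \<open>Freezing the time leaves spatial calculus for one square integrable field;
  \<open>\<psi>\<close> stands for the rescaled filter.\<close>

locale filtered_slice =
  fixes \<psi> :: "real^3 \<Rightarrow> real" and v :: "real^3 \<Rightarrow> real^3"
  assumes smooth: "smooth \<psi>" and supp: "bounded_support \<psi>" and v: "square_integrable v"
begin

definition U :: "real^3 \<Rightarrow> real^3" where
  "U = convolution \<psi> v"

definition R :: "real^3 \<Rightarrow> real^3^3" where
  "R x = convolution \<psi> (\<lambda>y. outer (v y) (v y)) x - outer (U x) (U x)"

abbreviation dU :: "3 \<Rightarrow> 3 \<Rightarrow> real^3 \<Rightarrow> real" where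
  "dU j i \<equiv> convolution (\<lambda>z. grad \<psi> z $ j) (\<lambda>y. v y $ i)"

lemma measurable_v [measurable]: "v \<in> borel_measurable borel"
  by (rule square_integrable_measurable[OF v])

lemmas cont = smooth_continuous[OF smooth]

lemma cont_grad: "continuous_on UNIV (\<lambda>z. grad \<psi> z $ j)"
  by (intro smooth_continuous smooth_grad_nth smooth)

lemma supp_grad: "bounded_support (\<lambda>z. grad \<psi> z $ j)"
  by (intro bounded_support_nth bounded_support_grad supp)

lemma locint: "locally_integrable (\<lambda>y. v y $ i)"
  by (intro locally_integrable_nth locally_integrable_square_integrable v)

lemma locint2: "locally_integrable (\<lambda>y. v y $ i * v y $ j)"
  by (intro locally_integrable_integrable integrable_mult_nth v)

lemma locint_outer: "locally_integrable (\<lambda>y. outer (v y) (v y))"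
proof (rule locally_integrable_integrable)
  have "integrable lborel (\<lambda>y. outer (v y) (v y) $ i)" for i
    by (rule integrable_vecI) (simp add: outer_def integrable_mult_nth v)
  have m: "(\<lambda>y. outer (v y) (v y)) \<in> borel_measurable borel"
    by (intro borel_measurable_vecI) (simp add: outer_def)
  \<comment> \<open>In the Frobenius norm a pure tensor has the squared norm of its vector, so
    square integrability of the slice is integrability of the tensor.\<close>
  have n: "norm (outer a a) = (norm a)\<^sup>2" for a
  proof -
    have "outer a a \<bullet> outer a a = (a \<bullet> a)\<^sup>2"
      by (simp add: inner_vec_def outer_def sum_3 power2_eq_square algebra_simps)
    then show ?thesis by (simp add: norm_eq_sqrt_inner[of "outer a a"] power2_norm_eq_inner)
  qed
  have "integrable lborel (\<lambda>y. norm (outer (v y) (v y)))"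
    using v by (simp add: n square_integrable_def)
  then show "integrable lborel (\<lambda>y. outer (v y) (v y))"
    using m by (simp add: integrable_norm_iff)
qed

lemma U_nth: "(\<lambda>x. U x $ i) = convolution \<psi> (\<lambda>y. v y $ i)"
  by (simp add: U_def fun_eq_iff convolution_nth cont supp locally_integrable_square_integrable v)

lemma C1_U: "C1 (\<lambda>x. U x $ i)" and grad_U: "grad (\<lambda>x. U x $ i) x $ j = dU j i x"
  unfolding U_nth by (intro C1_convolution smooth supp locint)+

lemma C1_dU: "C1 (dU j i)"
  and grad_dU: "grad (dU j i) x $ k = convolution (\<lambda>z. grad (\<lambda>z. grad \<psi> z $ j) z $ k) (\<lambda>y. v y $ i) x"
  by (intro C1_convolution smooth_grad_nth smooth supp_grad locint)+

lemma curl_U: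
  "curl U x $ 1 = dU 2 3 x - dU 3 2 x"
  "curl U x $ 2 = dU 3 1 x - dU 1 3 x"
  "curl U x $ 3 = dU 1 2 x - dU 2 1 x"
  by (simp_all add: curl_nth[OF C1_U] grad_U)

lemma C1_curl_U: "C1 (\<lambda>x. curl U x $ i)"
  using exhaust_3[of i] by (auto simp: curl_U C1_diff C1_dU)

lemma jacobian_curl_U:
  "jacobian (curl U) (at x) $ i $ j = grad (\<lambda>x. curl U x $ i) x $ j"
  by (rule jacobian_nth_C1[OF C1_curl_U])

lemma R_nth:
  "(\<lambda>x. R x $ i $ j) = (\<lambda>x. convolution \<psi> (\<lambda>y. v y $ i * v y $ j) x - U x $ i * U x $ j)"
proof -
  have "convolution \<psi> (\<lambda>y. outer (v y) (v y)) x $ i $ j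
      = convolution \<psi> (\<lambda>y. outer (v y) (v y) $ i $ j) x" for x
    by (simp add: convolution_nth cont supp locint_outer locally_integrable_nth)
  then show ?thesis by (simp add: R_def outer_def)
qed

lemma C1_R: "C1 (\<lambda>x. R x $ i $ j)"
  and grad_R: "grad (\<lambda>x. R x $ i $ j) x $ k =
    convolution (\<lambda>z. grad \<psi> z $ k) (\<lambda>y. v y $ i * v y $ j) x - (U x $ i * dU k j x + U x $ j * dU k i x)"
proof -
  note c = C1_convolution[OF smooth supp locint2]
  show "C1 (\<lambda>x. R x $ i $ j)"
    unfolding R_nth by (intro C1_diff C1_mult C1_U c)
  show "grad (\<lambda>x. R x $ i $ j) x $ k =
    convolution (\<lambda>z. grad \<psi> z $ k) (\<lambda>y. v y $ i * v y $ j) x - (U x $ i * dU k j x + U x $ j * dU k i x)"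
    unfolding R_nth by (simp add: grad_diff grad_mult C1_mult C1_U c grad_U)
qed

lemma div_R:
  "tensor_divergence R x $ i = (\<Sum>j\<in>UNIV. 
    convolution (\<lambda>z. grad \<psi> z $ j) (\<lambda>y. v y $ i * v y $ j) x - (U x $ i * dU j j x + U x $ j * dU j i x))"
  by (simp add: tensor_divergence_def divergence_def jacobian_nth_C1 C1_R grad_R)

lemma C1_div_R: "C1 (\<lambda>x. tensor_divergence R x $ i)"
  unfolding div_R
  by (intro C1_sum C1_diff C1_add C1_mult C1_U C1_dU C1_convolution smooth_grad_nth smooth supp_grad locint2) simp

subsection \<open>The commutator identity\<close>

definition comm_integrand :: "real^3 \<Rightarrow> real^3 \<Rightarrow> real^3" where
  "comm_integrand x z = (let \<delta> = v (x - z) - v x; w = U x - v x; g = grad \<psi> z in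
     (g \<bullet> \<delta>) *\<^sub>R \<delta> - (g \<bullet> \<delta>) *\<^sub>R w - (g \<bullet> w) *\<^sub>R \<delta>)"

lemma div_R_commutator:
  shows "integrable lborel (comm_integrand x)"
    and "tensor_divergence R x = (LINT z|lborel. comm_integrand x z)"
proof -
  \<comment> \<open>As \<delta> - w = v(x - z) - U(x), expanding the commutator integrand cancels
    the terms v_j(x) v_i(x - z). Apart from the integrand of the stress divergence, what remains is
    \<partial>_j \<psi>(z) times this coefficient, which does not depend on z and thus integrates to
    zero.\<close>
  define c where "c i j = v x $ j * U x $ i + U x $ j * v x $ i - v x $ j * v x $ i" for i j
  define T where "T i j z = grad \<psi> z $ j * (v (x - z) $ i * v (x - z) $ j)
      - (U x $ i * (grad \<psi> z $ j * v (x - z) $ j) + U x $ j * (grad \<psi> z $ j * v (x - z) $ i))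
      + c i j * grad \<psi> z $ j" for i j z
  have i2: "integrable lborel (\<lambda>z. grad \<psi> z $ j * (v (x - z) $ i * v (x - z) $ k))" for i j k
    using convolution_integrable[OF cont_grad supp_grad locint2, of j x i k] by simp
  have i1: "integrable lborel (\<lambda>z. grad \<psi> z $ j * v (x - z) $ i)" for i j
    using convolution_integrable[OF cont_grad supp_grad locint, of j x i] by simp
  have i0: "integrable lborel (\<lambda>z. grad \<psi> z $ j)" for j
    by (intro integrable_continuous_bounded_support cont_grad supp_grad)
  have iT: "integrable lborel (T i j)" for i j
    unfolding T_def by (intro Bochner_Integration.integrable_add Bochner_Integration.integrable_diff
        integrable_mult_right i0 i1 i2)
  have T: "(LINT z|lborel. T i j z) = convolution (\<lambda>z. grad \<psi> z $ j) (\<lambda>y. v y $ i * v y $ j) x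
      - (U x $ i * dU j j x + U x $ j * dU j i x)" for i j
    unfolding T_def convolution_def
    using i0 i1 i2 integral_grad_eq_0[OF smooth_C1[OF smooth] supp] by simp
  have eq: "comm_integrand x z $ i = (\<Sum>j\<in>UNIV. T i j z)" for i z
    by (simp add: comm_integrand_def Let_def inner_vec_def T_def c_def sum_3 algebra_simps)
  have int: "integrable lborel (\<lambda>z. comm_integrand x z $ i)" for i
    unfolding eq by (rule Bochner_Integration.integrable_sum) (rule iT)
  show iF: "integrable lborel (comm_integrand x)"
    by (rule integrable_vecI) (rule int)
  have "(LINT z|lborel. comm_integrand x z) $ i = tensor_divergence R x $ i" for i
  proof -
    have "(LINT z|lborel. comm_integrand x z) $ i = (LINT z|lborel. comm_integrand x z $ i)"
      using integral_bounded_linear[OF bounded_linear_vec_nth[of i] iF] by simp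
    also have "\<dots> = (\<Sum>j\<in>UNIV. LINT z|lborel. T i j z)"
      unfolding eq by (rule Bochner_Integration.integral_sum) (rule iT)
    finally show ?thesis by (simp add: T div_R)
  qed
  then show "tensor_divergence R x = (LINT z|lborel. comm_integrand x z)"
    by (simp add: vec_eq_iff)
qed

section \<open>Pointwise bounds for the stress divergence and for the curl of the vorticity\<close>

lemma norm_comm_integrand:
  "norm (comm_integrand x z) \<le> norm (grad \<psi> z) * (norm (v (x - z) - v x))\<^sup>2
     + 2 * norm (U x - v x) * (norm (grad \<psi> z) * norm (v (x - z) - v x))"
proof -
  define \<delta> w g where "\<delta> = v (x - z) - v x" and "w = U x - v x" and "g = grad \<psi> z"
  have cs: "norm ((g \<bullet> a) *\<^sub>R b) \<le> norm g * norm a * norm b" for a b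
    using Cauchy_Schwarz_ineq2[of g a] by (simp add: mult_right_mono)
  have "norm (comm_integrand x z)
      \<le> norm ((g \<bullet> \<delta>) *\<^sub>R \<delta>) + norm ((g \<bullet> \<delta>) *\<^sub>R w) + norm ((g \<bullet> w) *\<^sub>R \<delta>)"
    unfolding comm_integrand_def Let_def \<delta>_def[symmetric] w_def[symmetric] g_def[symmetric]
    using norm_triangle_ineq4 by (smt (verit))
  also have "\<dots> \<le> norm g * norm \<delta> * norm \<delta> + norm g * norm \<delta> * norm w + norm g * norm w * norm \<delta>"
    by (intro add_mono cs)
  finally show ?thesis
    by (simp add: \<delta>_def[symmetric] w_def[symmetric] g_def[symmetric] power2_eq_square algebra_simps)
qed

text \<open>The shape prepares for \<open>mu_measure\<close>: after normalising |\<nabla>\<psi>| the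
  two integrals are the second and the first moment of the increment, while U - v is constant in z
  and comes out of the integral.\<close>

lemma norm_div_R:
  "ennreal (norm (tensor_divergence R x))
    \<le> (\<integral>\<^sup>+z. ennreal (norm (grad \<psi> z)) * ennreal ((norm (v (x - z) - v x))\<^sup>2) \<partial>lborel)
      + ennreal (2 * norm (U x - v x)) *
          (\<integral>\<^sup>+z. ennreal (norm (grad \<psi> z)) * ennreal (norm (v (x - z) - v x)) \<partial>lborel)"
proof -
  have [measurable]: "grad \<psi> \<in> borel_measurable borel"
    by (intro borel_measurable_continuous_onI C1_continuous_grad smooth_C1 smooth)
  have "ennreal (norm (tensor_divergence R x)) \<le> (\<integral>\<^sup>+z. ennreal (norm (comm_integrand x z)) \<partial>lborel)"
    unfolding div_R_commutator(2) by (rule integral_norm_bound_ennreal[OF div_R_commutator(1)])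
  also have "\<dots> \<le> (\<integral>\<^sup>+z. ennreal (norm (grad \<psi> z)) * ennreal ((norm (v (x - z) - v x))\<^sup>2)
     + ennreal (2 * norm (U x - v x)) *
         (ennreal (norm (grad \<psi> z)) * ennreal (norm (v (x - z) - v x))) \<partial>lborel)"
  proof (rule nn_integral_mono)
    fix z
    show "ennreal (norm (comm_integrand x z)) \<le>
       ennreal (norm (grad \<psi> z)) * ennreal ((norm (v (x - z) - v x))\<^sup>2)
     + ennreal (2 * norm (U x - v x)) *
         (ennreal (norm (grad \<psi> z)) * ennreal (norm (v (x - z) - v x)))"
      using ennreal_leI[OF norm_comm_integrand[of x z]]
      by (simp add: ennreal_mult mult.assoc)
  qed
  also have "\<dots> = (\<integral>\<^sup>+z. ennreal (norm (grad \<psi> z)) * ennreal ((norm (v (x - z) - v x))\<^sup>2) \<partial>lborel)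
      + ennreal (2 * norm (U x - v x)) *
          (\<integral>\<^sup>+z. ennreal (norm (grad \<psi> z)) * ennreal (norm (v (x - z) - v x)) \<partial>lborel)"
    by (subst nn_integral_add, measurable, subst nn_integral_cmult, measurable)
  finally show ?thesis .
qed

lemma norm_U_diff:
  assumes "(LINT z|lborel. \<psi> z) = 1" "\<And>z. 0 \<le> \<psi> z"
  shows "ennreal (norm (U x - v x)) \<le> (\<integral>\<^sup>+z. ennreal (\<psi> z) * ennreal (norm (v (x - z) - v x)) \<partial>lborel)"
proof -
  have i: "integrable lborel (\<lambda>z. \<psi> z *\<^sub>R v (x - z))"
    by (intro convolution_integrable cont supp locally_integrable_square_integrable v)
  have i0: "integrable lborel \<psi>"
    by (intro integrable_continuous_bounded_support cont supp)
  have i0v: "integrable lborel (\<lambda>z. \<psi> z *\<^sub>R v x)"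
    using i0 by (intro integrable_scaleR_left)
  have eq: "U x - v x = (LINT z|lborel. \<psi> z *\<^sub>R (v (x - z) - v x))"
    using i i0 i0v assms(1) by (simp add: U_def convolution_def scaleR_diff_right)
  have "integrable lborel (\<lambda>z. \<psi> z *\<^sub>R (v (x - z) - v x))"
    using Bochner_Integration.integrable_diff[OF i i0v] by (simp add: scaleR_diff_right)
  then have "ennreal (norm (U x - v x)) \<le> (\<integral>\<^sup>+z. ennreal (norm (\<psi> z *\<^sub>R (v (x - z) - v x))) \<partial>lborel)"
    unfolding eq by (rule integral_norm_bound_ennreal)
  then show ?thesis using assms(2) by (simp add: ennreal_mult)
qed

lemma norm_curl_curl_U:
  "(norm (curl (curl U) x))\<^sup>2 \<le> 2 * (norm (jacobian (curl U) (at x)))\<^sup>2"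
proof -
  define J where "J = jacobian (curl U) (at x)"
  have sq: "(a - b)\<^sup>2 \<le> 2 * a\<^sup>2 + 2 * b\<^sup>2" for a b :: real
    using zero_le_power2[of "a + b"] by (simp add: power2_sum power2_diff)
  have "(norm (curl (curl U) x))\<^sup>2 = (J$3$2 - J$2$3)\<^sup>2 + (J$1$3 - J$3$1)\<^sup>2 + (J$2$1 - J$1$2)\<^sup>2"
    by (simp only: power2_norm_eq_inner inner_vec_def sum_3)
      (simp add: curl_def[of "curl U"] Let_def J_def power2_eq_square)
  also have "\<dots> \<le> (2 * (J$3$2)\<^sup>2 + 2 * (J$2$3)\<^sup>2) + (2 * (J$1$3)\<^sup>2 + 2 * (J$3$1)\<^sup>2)
      + (2 * (J$2$1)\<^sup>2 + 2 * (J$1$2)\<^sup>2)"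
    by (intro add_mono sq)
  also have "\<dots> \<le> 2 * (\<Sum>i\<in>UNIV. \<Sum>j\<in>UNIV. (J$i$j)\<^sup>2)"
    unfolding sum_3 by simp
  also have "(\<Sum>i\<in>UNIV. \<Sum>j\<in>UNIV. (J$i$j)\<^sup>2) = (norm J)\<^sup>2"
    by (simp only: power2_norm_eq_inner inner_vec_def) (simp add: power2_eq_square)
  finally show ?thesis by (simp add: J_def)
qed

end

section \<open>The increment defect controls the stress divergence\<close>

text \<open>
  With \<open>s\<close> the \<open>L\<^sup>q\<close> mean of \<open>f\<close>, Young's inequality gives \<open>f \<le> s powr (1 - q) * f powr q / q + (1 - 1 / q) * s\<close>.
\<close>

lemma nn_integral_le_powr_mean:
  fixes f :: "'a \<Rightarrow> real"
  assumes [measurable]: "f \<in> borel_measurable M" and M: "emeasure M (space M) = 1"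
    and nonneg: "\<And>x. 0 \<le> f x" and q: "1 \<le> q"
  shows "(\<integral>\<^sup>+x. ennreal (f x) \<partial>M) \<le> ennreal_powr (\<integral>\<^sup>+x. ennreal (f x powr q) \<partial>M) (1 / q)"
proof -
  define S where "S = (\<integral>\<^sup>+x. ennreal (f x powr q) \<partial>M)"
  \<comment> \<open>A zero mean cannot be scaled out, since its negative powers occur below, and an
    infinite one is handled by the convention in \<open>ennreal_powr\<close>. Young's inequality
    serves the remaining case.\<close>
  consider "S = \<infinity>" | "S = 0" | s where "S = ennreal s" "0 < s"
    by (metis ennreal_cases infinity_ennreal_def ennreal_0 order_le_less)
  then have "(\<integral>\<^sup>+x. ennreal (f x) \<partial>M) \<le> ennreal_powr S (1 / q)"
  proof cases
    case 1
    then show ?thesis by (simp add: ennreal_powr_def)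
  next
    case 2
    then have "AE x in M. ennreal (f x powr q) = 0"
      unfolding S_def by (subst (asm) nn_integral_0_iff_AE) auto
    then have "AE x in M. ennreal (f x) = 0"
      by (rule AE_mp) (auto intro!: AE_I2 simp: ennreal_eq_0_iff)
    then have "(\<integral>\<^sup>+x. ennreal (f x) \<partial>M) = 0"
      by (subst nn_integral_0_iff_AE) auto
    then show ?thesis by simp
  next
    case 3
    define m where "m = s powr (1 / q)"
    have m: "0 < m" "m powr q = s" using 3 q by (simp_all add: m_def powr_powr)
    define K where "K = m powr (1 - q) / q"
    have K: "0 \<le> K" using q by (simp add: K_def)
    have young: "f x \<le> K * f x powr q + (1 - 1 / q) * m" for x
    proof (cases "f x = 0")
      case True
      then show ?thesis using q m by simp
    next
      case False
      then have fx: "0 < f x" using nonneg[of x] by simp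
      \<comment> \<open>Young's inequality for the numbers
        \<open>f x powr q * m powr (1 - q)\<close> and \<open>m\<close> with weights 1/q and 1 -
        1/q: their weighted geometric mean is \<open>f x\<close>. Both arithmetic terms integrate to
        multiples of \<open>m\<close> that add up to \<open>m\<close>.\<close>
      have "(f x powr q * m powr (1 - q)) powr (1 / q) * m powr (1 - 1 / q)
          \<le> (1 / q) * (f x powr q * m powr (1 - q)) + (1 - 1 / q) * m"
        using fx m q by (intro Youngs_inequality_0) auto
      moreover have "(f x powr q * m powr (1 - q)) powr (1 / q) * m powr (1 - 1 / q) = f x"
      proof -
        have "(f x powr q * m powr (1 - q)) powr (1 / q) = f x * m powr ((1 - q) / q)"
          using fx m q by (simp add: powr_mult powr_powr)
        moreover have "m powr ((1 - q) / q) * m powr (1 - 1 / q) = m powr 0"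
          unfolding powr_add[symmetric] using q by (simp add: field_simps)
        ultimately show ?thesis using m by simp
      qed
      ultimately show ?thesis by (simp add: K_def mult_ac)
    qed
    have "(\<integral>\<^sup>+x. ennreal (f x) \<partial>M)
        \<le> (\<integral>\<^sup>+x. ennreal K * ennreal (f x powr q) + ennreal ((1 - 1 / q) * m) \<partial>M)"
    proof (rule nn_integral_mono)
      fix x
      show "ennreal (f x) \<le> ennreal K * ennreal (f x powr q) + ennreal ((1 - 1 / q) * m)"
        using ennreal_leI[OF young[of x]] q m K by (simp add: ennreal_mult)
    qed
    also have "\<dots> = ennreal K * S + ennreal ((1 - 1 / q) * m)"
      by (subst nn_integral_add) (auto simp: nn_integral_cmult S_def M)
    also have "\<dots> = ennreal (K * s + (1 - 1 / q) * m)"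
      using 3 q m K by (simp add: ennreal_mult)
    also have "K * s + (1 - 1 / q) * m = m"
    proof -
      have "m powr (1 - q) * s = m" using m by (simp add: m(2)[symmetric] powr_add[symmetric])
      then show ?thesis using q by (simp add: K_def field_simps)
    qed
    also have "ennreal m = ennreal_powr S (1 / q)"
      using 3 by (simp add: ennreal_powr_def m_def)
    finally show ?thesis .
  qed
  then show ?thesis by (simp add: S_def)
qed

text \<open>Jensen's inequality for the squares with exponent p/2; this is where \<open>p\<close>
  must be at least two.\<close>

lemma nn_integral_square_le_powr_mean:
  fixes f :: "'a \<Rightarrow> real"
  assumes [measurable]: "f \<in> borel_measurable M" and M: "emeasure M (space M) = 1"
    and nonneg: "\<And>x. 0 \<le> f x" and p: "2 \<le> p"
  shows "(\<integral>\<^sup>+x. ennreal ((f x)\<^sup>2) \<partial>M) \<le> (ennreal_powr (\<integral>\<^sup>+x. ennreal (f x powr p) \<partial>M) (1 / p))\<^sup>2"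
proof -
  have sq: "(f x)\<^sup>2 powr (p / 2) = f x powr p" for x
    using nonneg[of x] p by (cases "f x = 0") (simp_all add: powr_powr flip: powr_numeral)
  have pow: "ennreal_powr S (2 / p) = (ennreal_powr S (1 / p))\<^sup>2" for S
  proof (cases S)
    case (real r)
    then have "r powr (2 / p) = (r powr (1 / p))\<^sup>2"
      by (simp add: power2_eq_square powr_add[symmetric])
    with real show ?thesis by (simp add: ennreal_powr_def ennreal_power)
  next
    case top
    then show ?thesis by (simp add: ennreal_powr_def power_top_ennreal)
  qed
  show ?thesis
    using nn_integral_le_powr_mean[of "\<lambda>x. (f x)\<^sup>2" M "p / 2"] M p
    by (simp add: sq pow)
qed

subsection \<open>Scaling of the filter\<close>

lemma nn_integral_scaled:
  fixes f :: "real^3 \<Rightarrow> ennreal"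
  assumes [measurable]: "f \<in> borel_measurable borel" and l: "0 < l"
  shows "(\<integral>\<^sup>+z. f (z /\<^sub>R l) \<partial>lborel) = ennreal (l ^ 3) * (\<integral>\<^sup>+z. f z \<partial>lborel)"
proof -
  have "(\<integral>\<^sup>+z. f (z /\<^sub>R l) \<partial>lborel) =
      (\<integral>\<^sup>+z. f (z /\<^sub>R l) \<partial>density (distr lborel borel (\<lambda>x. 0 + l *\<^sub>R x)) (\<lambda>_. \<bar>l\<bar>^DIM(real^3)))"
    using l by (subst lborel_affine[of l 0]) auto
  also have "\<dots> = ennreal (l ^ 3) * (\<integral>\<^sup>+z. f z \<partial>lborel)"
    using l by (simp add: nn_integral_density nn_integral_distr nn_integral_cmult)
  finally show ?thesis .
qed

lemma rescale_eq: "rescale \<phi> l = (\<lambda>x. (1 / l ^ 3) * \<phi> (inverse l *\<^sub>R x))"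
  by (simp add: rescale_def fun_eq_iff)

lemma smooth_rescale: "smooth \<phi> \<Longrightarrow> smooth (rescale \<phi> l)"
  unfolding rescale_eq by (rule smooth_scaled)

lemma bounded_support_rescale:
  assumes "bounded_support \<phi>" "0 < l"
  shows "bounded_support (rescale \<phi> l)"
proof -
  obtain r where r: "\<And>x. r < norm x \<Longrightarrow> \<phi> x = 0"
    using assms(1) unfolding bounded_support_def by blast
  have "rescale \<phi> l x = 0" if "r * l < norm x" for x
    using that assms(2) by (simp add: rescale_def r field_simps)
  then show ?thesis unfolding bounded_support_def by blast
qed

lemma grad_rescale:
  assumes "C1 \<phi>" "0 < l"
  shows "grad (rescale \<phi> l) x = (1 / l ^ 4) *\<^sub>R grad \<phi> (x /\<^sub>R l)"
proof (rule grad_eqI)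
  have "((\<lambda>x. inverse l *\<^sub>R x) has_derivative (\<lambda>h. inverse l *\<^sub>R h)) (at x)"
    by (simp add: bounded_linear_imp_has_derivative bounded_linear_scaleR_right)
  from has_derivative_mult_right[OF has_derivative_compose[OF this C1_has_derivative[OF assms(1)]], of "1 / l ^ 3"]
  show "(rescale \<phi> l has_derivative (\<lambda>h. ((1 / l ^ 4) *\<^sub>R grad \<phi> (x /\<^sub>R l)) \<bullet> h)) (at x)"
    unfolding rescale_eq using assms(2) by (simp add: field_simps power4_eq_xxxx power3_eq_cube)
qed

lemma
  assumes "filter_kernel \<phi>"
  shows filter_kernel_smooth: "smooth \<phi>"
    and filter_kernel_bounded_support: "bounded_support \<phi>"
    and filter_kernel_nonneg: "0 \<le> \<phi> x"
    and filter_kernel_integral: "(LINT x|lborel. \<phi> x) = 1"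
  using assms by (auto simp: filter_kernel_def Cc_infinity_def compact_supp_bounded_support)

lemma filter_kernel_nn_integral:
  assumes \<phi>: "filter_kernel \<phi>" and l: "0 < l"
  shows "(\<integral>\<^sup>+z. ennreal (rescale \<phi> l z) \<partial>lborel) = 1"
    and "(\<integral>\<^sup>+z. ennreal (norm (grad (rescale \<phi> l) z)) \<partial>lborel) = ennreal (grad_L1 \<phi> / l)"
proof -
  note smooth = filter_kernel_smooth[OF \<phi>] and supp = filter_kernel_bounded_support[OF \<phi>]
  have c: "continuous_on UNIV \<phi>" "continuous_on UNIV (grad \<phi>)"
    by (intro smooth_continuous C1_continuous_grad smooth_C1 smooth)+
  then have [measurable]: "\<phi> \<in> borel_measurable borel" "grad \<phi> \<in> borel_measurable borel"
    by (auto intro: borel_measurable_continuous_onI)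
  have "(\<integral>\<^sup>+z. ennreal (\<phi> z) \<partial>lborel) = 1"
    using filter_kernel_nonneg[OF \<phi>] filter_kernel_integral[OF \<phi>]
      integrable_continuous_bounded_support[OF c(1) supp]
    by (subst nn_integral_eq_integral) auto
  then have "(\<integral>\<^sup>+z. ennreal (1 / l ^ 3) * ennreal (\<phi> (z /\<^sub>R l)) \<partial>lborel) = 1"
    using l by (subst nn_integral_cmult) (auto simp: nn_integral_scaled[where f = "\<lambda>z. ennreal (\<phi> z)"] ennreal_mult[symmetric] ennreal_1[symmetric] simp del: ennreal_1)
  then show "(\<integral>\<^sup>+z. ennreal (rescale \<phi> l z) \<partial>lborel) = 1"
    using l filter_kernel_nonneg[OF \<phi>] by (simp add: rescale_def ennreal_mult[symmetric])
  have "bounded_support (\<lambda>z. norm (grad \<phi> z))"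
    using bounded_support_grad[OF supp] unfolding bounded_support_def by (metis norm_zero)
  then have "integrable lborel (\<lambda>z. norm (grad \<phi> z))"
    by (intro integrable_continuous_bounded_support continuous_intros c)
  then have G: "(\<integral>\<^sup>+z. ennreal (norm (grad \<phi> z)) \<partial>lborel) = ennreal (grad_L1 \<phi>)"
    unfolding grad_L1_def by (subst nn_integral_eq_integral) auto
  have G0: "0 \<le> grad_L1 \<phi>" unfolding grad_L1_def by (rule Bochner_Integration.integral_nonneg) simp
  have "(\<integral>\<^sup>+z. ennreal (norm (grad (rescale \<phi> l) z)) \<partial>lborel)
      = (\<integral>\<^sup>+z. ennreal (1 / l ^ 4) * ennreal (norm (grad \<phi> (z /\<^sub>R l))) \<partial>lborel)"
    using l by (simp add: grad_rescale smooth_C1 smooth ennreal_mult[symmetric])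
  also have "\<dots> = ennreal (1 / l ^ 4) * (ennreal (l ^ 3) * ennreal (grad_L1 \<phi>))"
    using l by (subst nn_integral_cmult) (auto simp: nn_integral_scaled[where f = "\<lambda>z. ennreal (norm (grad \<phi> z))"] G)
  also have "\<dots> = ennreal (grad_L1 \<phi> / l)"
    using l G0 by (simp add: ennreal_mult[symmetric] field_simps power4_eq_xxxx power3_eq_cube)
  finally show "(\<integral>\<^sup>+z. ennreal (norm (grad (rescale \<phi> l) z)) \<partial>lborel) = ennreal (grad_L1 \<phi> / l)" .
qed

lemma grad_L1_nonneg: "0 \<le> grad_L1 \<phi>"
  unfolding grad_L1_def by (rule Bochner_Integration.integral_nonneg) simp

text \<open>Two measures enter because the integrand has two kinds of factors: the mean
  \<open>A\<close> over \<open>nu_measure\<close> controls U - u, and the mean \<open>B\<close> over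
  \<open>mu_measure\<close> controls the increments weighted by the kernel gradient. The quadratic
  term is bounded by B^2 and the two mixed terms together by 2AB, so completing the square loses no
  constant.\<close>

proposition norm_div_stress_le:
  assumes \<phi>: "filter_kernel \<phi>" and l: "0 < l" and p: "2 \<le> p" and v: "square_integrable (u t)"
  shows "ennreal (norm (tensor_divergence (stress \<phi> l u t) x))
    \<le> ennreal (grad_L1 \<phi> / l) * (increment_defect \<phi> l p u x t)\<^sup>2"
proof -
  define \<psi> where "\<psi> = rescale \<phi> l"
  interpret filtered_slice \<psi> "u t"
    by unfold_locales
      (auto simp: \<psi>_def v l smooth_rescale bounded_support_rescale filter_kernel_smooth[OF \<phi>]
        filter_kernel_bounded_support[OF \<phi>])
  have R: "stress \<phi> l u t = R"
    by (intro ext) (simp only: stress_def R_def U_def filtered_def \<psi>_def[symmetric])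
  define G where "G = grad_L1 \<phi>"
  have G0: "0 \<le> G" by (simp add: G_def grad_L1_nonneg)
  define d where "d z = norm (u t (x - z) - u t x)" for z
  have [measurable]: "d \<in> borel_measurable borel" unfolding d_def by measurable
  have gm [measurable]: "grad \<psi> \<in> borel_measurable borel"
    by (intro borel_measurable_continuous_onI C1_continuous_grad smooth_C1 smooth)
  have pm [measurable]: "\<psi> \<in> borel_measurable borel"
    by (intro borel_measurable_continuous_onI cont)
  have int1: "(\<integral>\<^sup>+z. ennreal (\<psi> z) \<partial>lborel) = 1"
    and intG: "(\<integral>\<^sup>+z. ennreal (norm (grad \<psi> z)) \<partial>lborel) = ennreal (G / l)"
    using filter_kernel_nn_integral[OF \<phi> l] by (simp_all add: \<psi>_def G_def)
  have \<psi>0: "0 \<le> \<psi> z" for z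
    using filter_kernel_nonneg[OF \<phi>] l by (simp add: \<psi>_def rescale_def)
  have "(LINT z|lborel. \<psi> z) = 1"
    using int1 \<psi>0 by (subst integral_eq_nn_integral) auto
  note w = norm_U_diff[OF this \<psi>0, of x, folded d_def]
  note V = norm_div_R[of x, folded d_def]
  show ?thesis
  \<comment> \<open>For \<open>G = 0\<close> the density of \<open>mu_measure\<close> is a division
    by zero, hence zero, and the measure has no unit mass for Jensen's inequality. In that case the
    gradient vanishes almost everywhere and both integrals in the bound are zero.\<close>
  proof (cases "G = 0")
    case True
    then have "(\<integral>\<^sup>+z. ennreal (norm (grad \<psi> z)) \<partial>lborel) = 0"
      using intG by simp
    then have "AE z in lborel. ennreal (norm (grad \<psi> z)) = 0"
      by (subst (asm) nn_integral_0_iff_AE) auto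
    then have "(\<integral>\<^sup>+z. ennreal (norm (grad \<psi> z)) * h z \<partial>lborel) = 0" for h
      by (subst nn_integral_cong_AE[where v = "\<lambda>_. 0"]) auto
    then show ?thesis using V by (simp add: R)
  next
    case False
    then have Gpos: "0 < G" using G0 by simp
    define A where "A = ennreal_powr (\<integral>\<^sup>+z. ennreal (d z powr p) \<partial>nu_measure \<phi> l) (1 / p)"
    define B where "B = ennreal_powr (\<integral>\<^sup>+z. ennreal (d z powr p) \<partial>mu_measure \<phi> l) (1 / p)"
    have defect: "increment_defect \<phi> l p u x t = A + B"
      by (simp add: increment_defect_def increment_def A_def B_def d_def)
    have nu: "nu_measure \<phi> l = density lborel (\<lambda>z. ennreal (\<psi> z))"
      by (simp add: nu_measure_def \<psi>_def)
    have mu: "mu_measure \<phi> l = density lborel (\<lambda>z. ennreal (l * norm (grad \<psi> z) / G))"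
      by (simp add: mu_measure_def \<psi>_def G_def)
    have grad_eq: "ennreal (norm (grad \<psi> z)) = ennreal (G / l) * ennreal (l * norm (grad \<psi> z) / G)" for z
      using Gpos l by (simp add: ennreal_mult[symmetric])
    have mu_int: "(\<integral>\<^sup>+z. ennreal (norm (grad \<psi> z)) * h z \<partial>lborel)
        = ennreal (G / l) * (\<integral>\<^sup>+z. h z \<partial>mu_measure \<phi> l)"
      if [measurable]: "h \<in> borel_measurable borel" for h
      unfolding mu grad_eq by (simp add: nn_integral_density mult.assoc nn_integral_cmult)
    have nu1: "emeasure (nu_measure \<phi> l) (space (nu_measure \<phi> l)) = 1"
      by (simp add: nu emeasure_density int1)
    have mu1: "emeasure (mu_measure \<phi> l) (space (mu_measure \<phi> l)) = 1"
    proof -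
      have "(\<integral>\<^sup>+z. ennreal (l * norm (grad \<psi> z) / G) \<partial>lborel)
          = (\<integral>\<^sup>+z. ennreal (l / G) * ennreal (norm (grad \<psi> z)) \<partial>lborel)"
        using Gpos l by (simp add: ennreal_mult[symmetric])
      also have "\<dots> = 1"
        using Gpos l by (subst nn_integral_cmult)
          (auto simp: intG ennreal_mult[symmetric] ennreal_1[symmetric] simp del: ennreal_1)
      finally show ?thesis by (simp add: mu emeasure_density)
    qed
    have m: "d \<in> borel_measurable (nu_measure \<phi> l)" "d \<in> borel_measurable (mu_measure \<phi> l)"
      by (simp_all add: nu mu)
    have d0: "0 \<le> d z" for z by (simp add: d_def)
    have "ennreal (norm (U x - u t x)) \<le> (\<integral>\<^sup>+z. ennreal (d z) \<partial>nu_measure \<phi> l)"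
      using w by (simp add: nu nn_integral_density)
    also have "\<dots> \<le> A"
      unfolding A_def using p by (intro nn_integral_le_powr_mean m nu1 d0) simp
    finally have wA: "ennreal (norm (U x - u t x)) \<le> A" .
    have B1: "(\<integral>\<^sup>+z. ennreal (d z) \<partial>mu_measure \<phi> l) \<le> B"
      unfolding B_def using p by (intro nn_integral_le_powr_mean m mu1 d0) simp
    have B2: "(\<integral>\<^sup>+z. ennreal ((d z)\<^sup>2) \<partial>mu_measure \<phi> l) \<le> B\<^sup>2"
      unfolding B_def by (intro nn_integral_square_le_powr_mean m mu1 d0 p)
    have "ennreal (norm (tensor_divergence R x))
        \<le> ennreal (G / l) * (\<integral>\<^sup>+z. ennreal ((d z)\<^sup>2) \<partial>mu_measure \<phi> l)
          + ennreal (2 * norm (U x - u t x)) * (ennreal (G / l) * (\<integral>\<^sup>+z. ennreal (d z) \<partial>mu_measure \<phi> l))"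
      using V by (simp add: mu_int)
    also have "ennreal (2 * norm (U x - u t x)) = 2 * ennreal (norm (U x - u t x))"
      by (simp add: ennreal_mult)
    also have "ennreal (G / l) * (\<integral>\<^sup>+z. ennreal ((d z)\<^sup>2) \<partial>mu_measure \<phi> l)
          + 2 * ennreal (norm (U x - u t x)) * (ennreal (G / l) * (\<integral>\<^sup>+z. ennreal (d z) \<partial>mu_measure \<phi> l))
        \<le> ennreal (G / l) * B\<^sup>2 + 2 * A * (ennreal (G / l) * B)"
      by (intro add_mono mult_mono wA B1 B2 order.refl) auto
    also have "\<dots> = ennreal (G / l) * (B\<^sup>2 + 2 * A * B)"
      by (simp add: algebra_simps)
    also have "\<dots> \<le> ennreal (G / l) * (A + B)\<^sup>2"
      by (intro mult_left_mono) (auto simp: power2_sum add.assoc intro: add_increasing)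
    finally show ?thesis by (simp add: R defect G_def)
  qed
qed

lemma norm_div_stress_square_le:
  assumes "filter_kernel \<phi>" "0 < l" "2 \<le> p" "square_integrable (u t)"
  shows "ennreal ((norm (tensor_divergence (stress \<phi> l u t) x))\<^sup>2)
    \<le> ennreal ((grad_L1 \<phi>)\<^sup>2 / l\<^sup>2) * increment_defect \<phi> l p u x t ^ 4"
proof -
  have "(ennreal (norm (tensor_divergence (stress \<phi> l u t) x)))\<^sup>2
      \<le> (ennreal (grad_L1 \<phi> / l) * (increment_defect \<phi> l p u x t)\<^sup>2)\<^sup>2"
    by (intro power_mono norm_div_stress_le assms) simp
  then show ?thesis
    using assms(2) grad_L1_nonneg[of \<phi>]
    by (simp add: power_mult_distrib ennreal_power power_divide flip: power_mult)
qed

section \<open>The rescaled cutoff\<close>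

lemma radius_pos: "0 < radius k"
  by (simp add: radius_def)

lemma radius_le_1: "radius k \<le> 1"
  by (simp add: radius_def power_le_one)

text \<open>Since r_k \<le> 1, every cylinder stays inside the unit time window on which the
  solution is given.\<close>

lemma cylinder_time: "(x, t) \<in> cylinder x0 t0 k \<Longrightarrow> t \<in> {t0 - 1<..<t0}"
  using power_le_one[of "radius k" 2] radius_le_1[of k] radius_pos[of k] by (auto simp: cylinder_def)

text \<open>The parabolic change of variables as a map on pairs, so that continuity and closed
  supports are pulled back from the profile as compositions and preimages.\<close>

definition to_profile :: "real^3 \<Rightarrow> real \<Rightarrow> nat \<Rightarrow> (real^3) \<times> real \<Rightarrow> (real^3) \<times> real" where
  "to_profile x0 t0 k p = ((fst p - x0) /\<^sub>R radius k, (snd p - t0) / (radius k)\<^sup>2)"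

context
  fixes \<theta> :: "(real^3) \<times> real \<Rightarrow> real"
  assumes \<theta>: "cutoff_profile \<theta>"
begin

lemma cutoff_profile_smooth: "smooth \<theta>"
  and cutoff_profile_compact: "compact (supp \<theta>)"
  and cutoff_profile_supp: "supp \<theta> \<subseteq> ball 0 1 \<times> {-1<..<0}"
  using \<theta> by (auto simp: cutoff_profile_def Cc_infinity_def)

lemma cutoff_range: "0 \<le> cutoff \<theta> x0 t0 k p" "cutoff \<theta> x0 t0 k p \<le> 1"
  using \<theta> by (auto simp: cutoff_profile_def cutoff_def split: prod.split)

lemma cutoff_eq: "cutoff \<theta> x0 t0 k p = \<theta> (to_profile x0 t0 k p)"
  by (cases p) (simp add: cutoff_def to_profile_def)

lemma continuous_to_profile: "continuous_on UNIV (to_profile x0 t0 k)"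
  unfolding to_profile_def using radius_pos[of k] by (intro continuous_intros) auto

lemma continuous_cutoff: "continuous_on UNIV (cutoff \<theta> x0 t0 k)"
  unfolding cutoff_eq[abs_def]
  by (rule continuous_on_compose2[OF smooth_continuous[OF cutoff_profile_smooth] continuous_to_profile]) auto

lemma to_profile_cylinder:
  assumes "to_profile x0 t0 k p \<in> supp \<theta>"
  shows "p \<in> cylinder x0 t0 k"
proof -
  have "to_profile x0 t0 k p \<in> ball 0 1 \<times> {-1<..<0}"
    using assms cutoff_profile_supp by blast
  then have "norm (fst p - x0) / radius k < 1" "- 1 < (snd p - t0) / (radius k)\<^sup>2"
    "(snd p - t0) / (radius k)\<^sup>2 < 0"
    unfolding to_profile_def mem_Sigma_iff mem_ball_0 greaterThanLessThan_iff norm_scaleR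
    using radius_pos[of k] by (simp_all add: divide_inverse mult.commute)
  then have "norm (fst p - x0) < radius k" "- (radius k)\<^sup>2 < snd p - t0" "snd p - t0 < 0"
    using radius_pos[of k] by (simp_all add: field_simps)
  then show ?thesis
    by (cases p) (simp add: cylinder_def dist_norm norm_minus_commute)
qed

lemma cutoff_outside: "p \<notin> cylinder x0 t0 k \<Longrightarrow> cutoff \<theta> x0 t0 k p = 0"
  unfolding cutoff_eq using to_profile_cylinder zero_outside_supp by blast

lemma frechet_derivative_outside_supp:
  assumes "q \<notin> supp \<theta>"
  shows "frechet_derivative \<theta> (at q) = (\<lambda>_. 0)"
proof -
  have o: "open (- supp \<theta>)" unfolding supp_def by (intro open_Compl closed_closure)
  have "((\<lambda>_. 0) has_derivative (\<lambda>_. 0)) (at q)" by simp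
  then have "(\<theta> has_derivative (\<lambda>_. 0)) (at q)"
    by (rule has_derivative_transform_within_open[OF _ o]) (use assms in \<open>simp_all add: zero_outside_supp\<close>)
  then show ?thesis using frechet_derivative_at by metis
qed

lemma
  shows C1_cutoff: "C1 (\<lambda>y. cutoff \<theta> x0 t0 k (y, t))"
    and grad_cutoff: "grad (\<lambda>y. cutoff \<theta> x0 t0 k (y, t)) x =
      (1 / radius k) *\<^sub>R (\<chi> j. frechet_derivative \<theta> (at (to_profile x0 t0 k (x, t))) (axis j 1, 0))"
proof -
  let ?T = "\<lambda>y. to_profile x0 t0 k (y, t)"
  let ?g = "\<lambda>x. (1 / radius k) *\<^sub>R (\<chi> j. frechet_derivative \<theta> (at (?T x)) (axis j 1, 0))"
  have d: "((\<lambda>y. cutoff \<theta> x0 t0 k (y, t)) has_derivative (\<lambda>h. ?g x \<bullet> h)) (at x)" for x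
  proof -
    have \<theta>d: "(\<theta> has_derivative frechet_derivative \<theta> (at (?T x))) (at (?T x))"
      using smooth_differentiable[OF cutoff_profile_smooth] by (simp add: frechet_derivative_works)
    have "(?T has_derivative (\<lambda>h. (h /\<^sub>R radius k, 0))) (at x)"
      unfolding to_profile_def by (auto intro!: derivative_eq_intros)
    from has_derivative_compose[OF this \<theta>d]
    have D: "((\<lambda>y. cutoff \<theta> x0 t0 k (y, t)) has_derivative
        (\<lambda>h. frechet_derivative \<theta> (at (?T x)) (h /\<^sub>R radius k, 0))) (at x)"
      by (simp add: cutoff_eq)
    have "frechet_derivative \<theta> (at (?T x)) (h /\<^sub>R radius k, 0) = ?g x \<bullet> h" for h
    proof -
      note lin = has_derivative_linear[OF D]
      have "frechet_derivative \<theta> (at (?T x)) (axis j 1 /\<^sub>R radius k, 0)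
          = (1 / radius k) * frechet_derivative \<theta> (at (?T x)) (axis j 1, 0)" for j
        using linear_scale[OF has_derivative_linear[OF \<theta>d], of "1 / radius k" "(axis j 1, 0)"]
        by (simp add: divide_inverse)
      then show ?thesis
        unfolding linear_eq_inner_axis[OF lin, of h]
        by (simp add: inner_vec_def sum_distrib_left mult.assoc)
    qed
    with D show ?thesis by simp
  qed
  have "continuous_on UNIV (\<lambda>x. frechet_derivative \<theta> (at (?T x)) v)" for v
    by (rule continuous_on_compose2[OF smooth_continuous[OF smooth_frechet_derivative[OF cutoff_profile_smooth]]
          continuous_on_compose2[OF continuous_to_profile]]) (auto intro!: continuous_intros)
  then have c: "continuous_on UNIV ?g"
    by (intro continuous_on_scaleR continuous_on_const continuous_on_vec_lambda)
  show "C1 (\<lambda>y. cutoff \<theta> x0 t0 k (y, t))" by (rule C1I(1)[OF d c])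
  show "grad (\<lambda>y. cutoff \<theta> x0 t0 k (y, t)) x = ?g x" by (simp only: C1I(2)[OF d c])
qed

lemma bounded_support_cutoff: "bounded_support (\<lambda>y. cutoff \<theta> x0 t0 k (y, t))"
proof -
  have "cutoff \<theta> x0 t0 k (y, t) = 0" if "norm x0 + radius k < norm y" for y
  proof (rule cutoff_outside)
    have "norm y \<le> norm x0 + dist x0 y" using norm_triangle_sub[of y x0] by (simp add: dist_norm norm_minus_commute)
    with that show "(y, t) \<notin> cylinder x0 t0 k" by (auto simp: cylinder_def)
  qed
  then show ?thesis unfolding bounded_support_def by blast
qed

text \<open>The chain rule splits off the factor 1/r_k. What is left are values of the first
  derivatives of the profile, bounded by compactness of its support; the constant is therefore
  uniform in the centre and the scale.\<close>

lemma grad_cutoff_bound: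
  obtains C where "0 < C"
    "\<And>x0 t0 k t x. norm (grad (\<lambda>y. cutoff \<theta> x0 t0 k (y, t)) x) \<le> C / radius k"
proof -
  have "\<exists>B>0. \<forall>q. norm (frechet_derivative \<theta> (at q) (axis j 1, 0)) \<le> B" for j
  proof -
    have "bounded_support (\<lambda>q. frechet_derivative \<theta> (at q) (axis j 1, 0))"
    proof -
      obtain r where r: "\<And>q. q \<in> supp \<theta> \<Longrightarrow> norm q \<le> r"
        using compact_imp_bounded[OF cutoff_profile_compact] by (auto simp: bounded_iff)
      have "frechet_derivative \<theta> (at q) (axis j 1, 0) = 0" if "r < norm q" for q
      proof -
        have "q \<notin> supp \<theta>" using r[of q] that by auto
        then show ?thesis by (simp add: frechet_derivative_outside_supp)
      qed
      then show ?thesis unfolding bounded_support_def by blast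
    qed
    from continuous_bounded_support_bound[OF smooth_continuous[OF smooth_frechet_derivative[OF cutoff_profile_smooth]] this]
    show ?thesis by blast
  qed
  then obtain B where B: "\<And>j. 0 < B j"
    "\<And>j q. norm (frechet_derivative \<theta> (at q) (axis j 1, 0)) \<le> B j" by metis
  show ?thesis
  proof (rule that[of "\<Sum>j\<in>UNIV. B j"])
    show "0 < (\<Sum>j\<in>UNIV. B j)" by (intro sum_pos B) auto
    fix x0 t0 k t x
    let ?d = "\<chi> j. frechet_derivative \<theta> (at (to_profile x0 t0 k (x, t))) (axis j 1, 0)"
    have "norm ?d \<le> (\<Sum>j\<in>UNIV. \<bar>?d $ j\<bar>)" by (rule norm_le_l1_cart)
    also have "\<dots> \<le> (\<Sum>j\<in>UNIV. B j)" using B(2) by (intro sum_mono) simp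
    finally show "norm (grad (\<lambda>y. cutoff \<theta> x0 t0 k (y, t)) x) \<le> (\<Sum>j\<in>UNIV. B j) / radius k"
      using radius_pos[of k] by (simp add: grad_cutoff divide_right_mono)
  qed
qed

lemma closed_shell: "closed (shell \<theta> x0 t0 k)"
  by (simp add: shell_def supp_def)

lemma grad_cutoff_outside_shell:
  "(x, t) \<notin> shell \<theta> x0 t0 k \<Longrightarrow> grad (\<lambda>y. cutoff \<theta> x0 t0 k (y, t)) x = 0"
  using zero_outside_supp[of "(x, t)" "\<lambda>(x, t). grad (\<lambda>y. cutoff \<theta> x0 t0 k (y, t)) x"]
  by (simp add: shell_def)

text \<open>The shell is a closure and the cylinder is open, so vanishing of the gradient off the
  cylinder would not suffice. The preimage of the closed support of the profile is a closed set
  lying between the two.\<close>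

lemma shell_subset_cylinder: "shell \<theta> x0 t0 k \<subseteq> cylinder x0 t0 k"
proof -
  have c: "closed (to_profile x0 t0 k -` supp \<theta>)"
    by (intro closed_vimage continuous_to_profile) (simp add: supp_def)
  have "{p. (\<lambda>(x, t). grad (\<lambda>y. cutoff \<theta> x0 t0 k (y, t)) x) p \<noteq> 0} \<subseteq> to_profile x0 t0 k -` supp \<theta>"
  proof (clarify, rule ccontr)
    fix x t
    assume "(x, t) \<notin> to_profile x0 t0 k -` supp \<theta>"
    then have "grad (\<lambda>y. cutoff \<theta> x0 t0 k (y, t)) x = 0"
      by (simp add: grad_cutoff frechet_derivative_outside_supp vec_eq_iff)
    moreover assume "grad (\<lambda>y. cutoff \<theta> x0 t0 k (y, t)) x \<noteq> 0"
    ultimately show False by simp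
  qed
  from closure_minimal[OF this c]
  have "shell \<theta> x0 t0 k \<subseteq> to_profile x0 t0 k -` supp \<theta>"
    by (simp only: shell_def supp_def)
  then show ?thesis using to_profile_cylinder by blast
qed

end

section \<open>Joint measurability\<close>

text \<open>A Bochner integral depends measurably on parameters when its integrand is jointly
  measurable; at parameters where the integrand is not integrable it takes the value zero.\<close>

lemma borel_measurable_convolution:
  fixes f :: "(real^3) \<times> real \<Rightarrow> real"
  assumes [measurable]: "\<psi> \<in> borel_measurable borel" "f \<in> borel_measurable borel"
  shows "(\<lambda>p. convolution \<psi> (\<lambda>y. f (y, snd p)) (fst p)) \<in> borel_measurable borel"
proof -
  have "(\<lambda>q. (fst (fst q) - snd q, snd (fst q))) \<in> borel \<Otimes>\<^sub>M borel \<rightarrow>\<^sub>M (borel :: ((real^3) \<times> real) measure)"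
    unfolding borel_prod[symmetric] by measurable
  then have "(\<lambda>q. f (fst (fst q) - snd q, snd (fst q))) \<in> borel_measurable (borel \<Otimes>\<^sub>M lborel)"
    by (intro measurable_compose[OF _ assms(2)]) simp
  then have "(\<lambda>(p, z). \<psi> z *\<^sub>R f (fst p - z, snd p)) \<in> borel_measurable (borel \<Otimes>\<^sub>M lborel)"
    unfolding case_prod_unfold by measurable
  then show ?thesis
    unfolding convolution_def by (rule lborel.borel_measurable_lebesgue_integral)
qed

text \<open>The conditions hold at every real time, so the slice formulas are valid on all of
  space-time and can be fed into measurability arguments there. Extension by zero in time will
  supply them.\<close>

locale filtered_flow =
  fixes \<phi> :: "real^3 \<Rightarrow> real" and l :: real and u :: "real \<Rightarrow> real^3 \<Rightarrow> real^3"
  assumes \<phi>: "filter_kernel \<phi>" and l: "0 < l"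
    and u_measurable: "(\<lambda>(x, t). u t x) \<in> borel_measurable borel"
    and u_square: "\<And>t. square_integrable (u t)"
begin

lemma slice: "filtered_slice (rescale \<phi> l) (u t)"
  by unfold_locales
    (auto simp: u_square l smooth_rescale bounded_support_rescale filter_kernel_smooth[OF \<phi>]
      filter_kernel_bounded_support[OF \<phi>])

lemma filtered_eq: "filtered \<phi> l u t = filtered_slice.U (rescale \<phi> l) (u t)"
  unfolding filtered_def filtered_slice.U_def[OF slice] ..

lemma vorticity_eq: "vorticity \<phi> l u t = curl (filtered_slice.U (rescale \<phi> l) (u t))"
  by (simp add: vorticity_def filtered_eq)

lemma stress_eq: "stress \<phi> l u t = filtered_slice.R (rescale \<phi> l) (u t)"
  by (intro ext) (simp only: stress_def filtered_slice.R_def[OF slice] filtered_eq)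

text \<open>\<open>h\<close> selects a component of the velocity or a product of two, so that the
  filtered field, its derivatives and the quadratic part of the stress are covered at once.\<close>

lemma convolution_measurable:
  fixes h :: "real^3 \<Rightarrow> real"
  assumes "smooth \<psi>" "h \<in> borel_measurable borel"
  shows "(\<lambda>p. convolution \<psi> (\<lambda>y. h (u (snd p) y)) (fst p)) \<in> borel_measurable borel"
proof -
  have "(\<lambda>p. h ((\<lambda>(x, t). u t x) p)) \<in> borel_measurable borel"
    by (rule measurable_compose[OF u_measurable assms(2)])
  from borel_measurable_convolution[OF borel_measurable_continuous_onI[OF smooth_continuous[OF assms(1)]] this]
  show ?thesis by simp
qed

lemma nth_measurable: "(\<lambda>a::real^3. a $ i) \<in> borel_measurable borel"
  by (intro borel_measurable_continuous_onI continuous_intros)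

lemmas smooth_kernel = smooth_rescale[OF filter_kernel_smooth[OF \<phi>], of l]

lemma dU_measurable:
  "(\<lambda>p. convolution (\<lambda>z. grad (rescale \<phi> l) z $ j) (\<lambda>y. u (snd p) y $ i) (fst p)) \<in> borel_measurable borel"
  by (rule convolution_measurable[OF smooth_grad_nth[OF smooth_kernel] nth_measurable])

text \<open>Measurability in the pair is obtained from the explicit convolution formulas on the
  slices, in place of limits of difference quotients.\<close>

lemma vorticity_measurable: "(\<lambda>p. vorticity \<phi> l u (snd p) (fst p)) \<in> borel_measurable borel"
proof (rule borel_measurable_vecI)
  fix i :: 3
  show "(\<lambda>p. vorticity \<phi> l u (snd p) (fst p) $ i) \<in> borel_measurable borel"
    using exhaust_3[of i]
    by (auto simp: vorticity_eq filtered_slice.curl_U[OF slice] intro!: borel_measurable_diff dU_measurable)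
qed

lemma jacobian_vorticity_measurable:
  "(\<lambda>p. jacobian (vorticity \<phi> l u (snd p)) (at (fst p))) \<in> borel_measurable borel"
proof (intro borel_measurable_vecI)
  fix i j :: 3
  have m: "(\<lambda>p. convolution (\<lambda>z. grad (\<lambda>z. grad (rescale \<phi> l) z $ a) z $ b)
      (\<lambda>y. u (snd p) y $ c) (fst p)) \<in> borel_measurable borel" for a b c
    by (rule convolution_measurable[OF smooth_grad_nth[OF smooth_grad_nth[OF smooth_kernel]] nth_measurable])
  show "(\<lambda>p. jacobian (vorticity \<phi> l u (snd p)) (at (fst p)) $ i $ j) \<in> borel_measurable borel"
    unfolding vorticity_eq filtered_slice.jacobian_curl_U[OF slice]
    using exhaust_3[of i]
    by (auto simp: filtered_slice.curl_U[OF slice] grad_diff filtered_slice.C1_dU[OF slice]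
        filtered_slice.grad_dU[OF slice] intro!: borel_measurable_diff m)
qed

lemma div_stress_measurable:
  "(\<lambda>p. tensor_divergence (stress \<phi> l u (snd p)) (fst p)) \<in> borel_measurable borel"
proof (rule borel_measurable_vecI)
  fix i :: 3
  have U: "filtered_slice.U (rescale \<phi> l) (u t) x $ k = convolution (rescale \<phi> l) (\<lambda>y. u t y $ k) x" for t x k
    using filtered_slice.U_nth[OF slice, of t k] by (rule fun_cong)
  have mU: "(\<lambda>p. convolution (rescale \<phi> l) (\<lambda>y. u (snd p) y $ k) (fst p)) \<in> borel_measurable borel" for k
    by (rule convolution_measurable[OF smooth_kernel nth_measurable])
  have m2: "(\<lambda>p. convolution (\<lambda>z. grad (rescale \<phi> l) z $ j) (\<lambda>y. u (snd p) y $ i * u (snd p) y $ j) (fst p))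
      \<in> borel_measurable borel" for j
    by (rule convolution_measurable[OF smooth_grad_nth[OF smooth_kernel], of "\<lambda>a. a $ i * a $ j"])
      (intro borel_measurable_times nth_measurable)
  show "(\<lambda>p. tensor_divergence (stress \<phi> l u (snd p)) (fst p) $ i) \<in> borel_measurable borel"
    unfolding stress_eq filtered_slice.div_R[OF slice] U
    by (intro borel_measurable_sum borel_measurable_diff borel_measurable_add borel_measurable_times
        m2 mU dU_measurable)
qed

end

section \<open>The commutator flux\<close>

lemma young_weighted:
  fixes a b :: real
  assumes "0 < e"
  shows "a * b \<le> e / 2 * a\<^sup>2 + b\<^sup>2 / (2 * e)"
proof -
  have "0 \<le> (e * a - b)\<^sup>2" by (rule zero_le_power2)
  then have "2 * e * (a * b) \<le> e\<^sup>2 * a\<^sup>2 + b\<^sup>2" by (simp add: power2_diff power_mult_distrib mult_ac)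
  then show ?thesis using assms by (simp add: field_simps power2_eq_square)
qed

text \<open>
  The upper function \<open>g\<close> need not be measurable; the defect plays its role, so its joint
  measurability never has to be established.
\<close>

lemma nn_integral_cmult_le:
  assumes [measurable]: "f \<in> borel_measurable M" and c: "0 \<le> c"
    and le: "\<And>x. f x \<le> ennreal c * g x"
  shows "integral\<^sup>N M f \<le> ennreal c * integral\<^sup>N M g"
proof (cases "c = 0")
  case True
  then have "f = (\<lambda>_. 0)" using le by auto
  then show ?thesis by simp
next
  case False
  \<comment> \<open>Pulling a constant out of an integral asks for measurability, so this is done on
    the side of \<open>f\<close>; on the side of \<open>g\<close> monotonicity is enough.\<close>
  have "integral\<^sup>N M f = (\<integral>\<^sup>+x. ennreal c * (ennreal (1 / c) * f x) \<partial>M)"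
    using False c by (simp add: mult.assoc[symmetric] ennreal_mult[symmetric])
  also have "\<dots> = ennreal c * (\<integral>\<^sup>+x. ennreal (1 / c) * f x \<partial>M)"
    by (rule nn_integral_cmult) measurable
  also have "\<dots> \<le> ennreal c * integral\<^sup>N M g"
  proof (intro mult_left_mono nn_integral_mono)
    fix x
    have "ennreal (1 / c) * f x \<le> ennreal (1 / c) * (ennreal c * g x)"
      by (intro mult_left_mono le) simp
    then show "ennreal (1 / c) * f x \<le> g x"
      using False c by (simp add: mult.assoc[symmetric] ennreal_mult[symmetric])
  qed simp
  finally show ?thesis .
qed

text \<open>The weight is general because it will be both the cutoff in the flux and the indicator
  of the shell. The prefactors match: r (G/l)^2 = G^2 (r/l^2) with G the L^1 norm of
  \<nabla>\<phi>.\<close>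

lemma (in filtered_flow) weighted_div_stress_le:
  assumes \<sigma>: "l = \<sigma> * radius k" and p: "2 \<le> p"
    and w: "w \<in> borel_measurable borel" "\<And>q. 0 \<le> w q"
  shows "ennreal (radius k) * (\<integral>\<^sup>+q. ennreal (w q * (norm (tensor_divergence (stress \<phi> l u (snd q)) (fst q)))\<^sup>2) \<partial>lborel)
    \<le> ennreal ((grad_L1 \<phi>)\<^sup>2) * weighted_defect \<phi> \<sigma> p w u k"
proof -
  note [measurable] = div_stress_measurable w(1)
  let ?D = "\<lambda>q. increment_defect \<phi> l p u (fst q) (snd q)"
  have "(\<integral>\<^sup>+q. ennreal (w q * (norm (tensor_divergence (stress \<phi> l u (snd q)) (fst q)))\<^sup>2) \<partial>lborel)
      \<le> ennreal ((grad_L1 \<phi>)\<^sup>2 / l\<^sup>2) * (\<integral>\<^sup>+q. ennreal (w q) * ?D q ^ 4 \<partial>lborel)"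
  proof (rule nn_integral_cmult_le)
    show "(\<lambda>q. ennreal (w q * (norm (tensor_divergence (stress \<phi> l u (snd q)) (fst q)))\<^sup>2)) \<in> borel_measurable lborel"
      by simp
    fix q
    have "ennreal (w q) * ennreal ((norm (tensor_divergence (stress \<phi> l u (snd q)) (fst q)))\<^sup>2)
        \<le> ennreal (w q) * (ennreal ((grad_L1 \<phi>)\<^sup>2 / l\<^sup>2) * ?D q ^ 4)"
      by (intro mult_left_mono norm_div_stress_square_le \<phi> l p u_square) simp
    then show "ennreal (w q * (norm (tensor_divergence (stress \<phi> l u (snd q)) (fst q)))\<^sup>2)
        \<le> ennreal ((grad_L1 \<phi>)\<^sup>2 / l\<^sup>2) * (ennreal (w q) * ?D q ^ 4)"
      using w(2) by (simp add: ennreal_mult mult_ac)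
  qed simp
  then have "ennreal (radius k) * (\<integral>\<^sup>+q. ennreal (w q * (norm (tensor_divergence (stress \<phi> l u (snd q)) (fst q)))\<^sup>2) \<partial>lborel)
      \<le> ennreal (radius k) * (ennreal ((grad_L1 \<phi>)\<^sup>2 / l\<^sup>2) * (\<integral>\<^sup>+q. ennreal (w q) * ?D q ^ 4 \<partial>lborel))"
    by (rule mult_left_mono) simp
  also have "\<dots> = ennreal ((grad_L1 \<phi>)\<^sup>2) * weighted_defect \<phi> \<sigma> p w u k"
  proof -
    have "ennreal (radius k) * ennreal ((grad_L1 \<phi>)\<^sup>2 / l\<^sup>2)
        = ennreal ((grad_L1 \<phi>)\<^sup>2) * ennreal (radius k / l\<^sup>2)"
      using radius_pos[of k] by (simp add: ennreal_mult[symmetric])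
    then show ?thesis
      by (simp add: weighted_defect_def \<sigma>[symmetric] case_prod_unfold mult.assoc[symmetric])
  qed
  finally show ?thesis .
qed

text \<open>The bound comes from integration by parts in x, so it holds for slice integrals and not
  pointwise, and it passes to space-time through Fubini's theorem for the signed integral. If
  \<open>f\<close> is not jointly integrable, its integral is zero by convention and the claim is
  trivial.\<close>

lemma abs_integral_le_iterated:
  fixes f :: "(real^3) \<times> real \<Rightarrow> real"
  assumes "\<And>t. ennreal \<bar>LINT x|lborel. f (x, t)\<bar> \<le> (\<integral>\<^sup>+x. h (x, t) \<partial>lborel)"
    and h: "h \<in> borel_measurable borel"
  shows "ennreal \<bar>LINT q|lborel. f q\<bar> \<le> (\<integral>\<^sup>+q. h q \<partial>lborel)"
proof (cases "integrable lborel f")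
  case True
  then have i: "integrable (lborel \<Otimes>\<^sub>M lborel) (case_prod (\<lambda>x t. f (x, t)))"
    by (simp add: lborel_prod)
  have "(LINT q|lborel. f q) = (LINT t|lborel. LINT x|lborel. f (x, t))"
    using lborel_pair.integral_snd[OF i] by (simp add: lborel_prod)
  then have "ennreal \<bar>LINT q|lborel. f q\<bar> \<le> (\<integral>\<^sup>+t. ennreal \<bar>LINT x|lborel. f (x, t)\<bar> \<partial>lborel)"
    using integral_norm_bound_ennreal[OF lborel_pair.integrable_snd[OF i]] by simp
  also have "\<dots> \<le> (\<integral>\<^sup>+t. \<integral>\<^sup>+x. h (x, t) \<partial>lborel \<partial>lborel)"
    by (intro nn_integral_mono assms)
  also have "\<dots> = (\<integral>\<^sup>+q. h q \<partial>lborel)"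
  proof -
    have "h \<in> borel_measurable (lborel \<Otimes>\<^sub>M lborel)" using h by (simp add: lborel_prod)
    from lborel_pair.nn_integral_snd[OF this] show ?thesis by (simp add: lborel_prod)
  qed
  finally show ?thesis .
next
  case False
  then show ?thesis by (simp add: not_integrable_integral_eq)
qed

lemma (in filtered_flow) F_com_le:
  assumes \<theta>: "cutoff_profile \<theta>" and C: "0 < C"
    and grad: "\<And>t x. norm (grad (\<lambda>y. cutoff \<theta> x0 t0 k (y, t)) x) \<le> C / radius k"
    and \<sigma>: "l = \<sigma> * radius k" and p: "2 \<le> p" and \<eta>: "0 < \<eta>"
  shows "ennreal (F_com \<phi> \<theta> x0 t0 \<sigma> u k)
     \<le> ennreal \<eta> * P_pal \<phi> \<theta> x0 t0 \<sigma> u k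
       + ennreal ((grad_L1 \<phi>)\<^sup>2 / \<eta>) * S_tilde \<phi> \<theta> x0 t0 \<sigma> p u k
       + L_inc C \<phi> \<theta> x0 t0 \<sigma> u k"
proof -
  define r where "r = radius k"
  have r: "0 < r" by (simp add: r_def radius_pos)
  define c where "c = cutoff \<theta> x0 t0 k"
  define S where "S = (indicator (shell \<theta> x0 t0 k) :: _ \<Rightarrow> real)"
  define J where "J q = norm (jacobian (vorticity \<phi> l u (snd q)) (at (fst q)))" for q
  define V where "V q = norm (tensor_divergence (stress \<phi> l u (snd q)) (fst q))" for q
  define W where "W q = norm (vorticity \<phi> l u (snd q) (fst q))" for q
  have c0: "0 \<le> c q" for q by (simp add: c_def cutoff_range[OF \<theta>])
  have S0: "0 \<le> S q" for q by (simp add: S_def)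
  have cm [measurable]: "c \<in> borel_measurable borel"
    unfolding c_def by (intro borel_measurable_continuous_onI continuous_cutoff \<theta>)
  have Sm [measurable]: "S \<in> borel_measurable borel"
    unfolding S_def using closed_shell[OF \<theta>] by (intro borel_measurable_indicator) auto
  note [measurable] = jacobian_vorticity_measurable vorticity_measurable div_stress_measurable
  have JVO [measurable]: "J \<in> borel_measurable borel" "V \<in> borel_measurable borel" "W \<in> borel_measurable borel"
    unfolding J_def V_def W_def by measurable

  define h1 h2 h3 h4 where "h1 q = c q * (J q)\<^sup>2" and "h2 q = c q * (V q)\<^sup>2"
    and "h3 q = S q * (W q)\<^sup>2" and "h4 q = S q * (V q)\<^sup>2" for q
  note h_defs = h1_def h2_def h3_def h4_def
  have h0: "0 \<le> h1 q" "0 \<le> h2 q" "0 \<le> h3 q" "0 \<le> h4 q" for q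
    by (simp_all add: h_defs c0 S0)
  have hm [measurable]: "h1 \<in> borel_measurable borel" "h2 \<in> borel_measurable borel"
      "h3 \<in> borel_measurable borel" "h4 \<in> borel_measurable borel"
    unfolding h_defs by measurable
  define H where "H q = ennreal \<eta> * ennreal (h1 q) + ennreal (1 / (2 * \<eta>)) * ennreal (h2 q)
      + ennreal (C / (2 * r\<^sup>2)) * ennreal (h3 q) + ennreal (C / 2) * ennreal (h4 q)" for q
  \<comment> \<open>The sum of \<open>ennreal\<close> terms is integrated term by term; the single
    real expression is what the pointwise inequalities are compared with.\<close>
  have H: "H q = ennreal (\<eta> * h1 q + 1 / (2 * \<eta>) * h2 q + C / (2 * r\<^sup>2) * h3 q + C / 2 * h4 q)" for q
    unfolding H_def using \<eta> C h0[of q] by (simp add: ennreal_mult[symmetric] del: times_divide_eq_left)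
  have Hm: "H \<in> borel_measurable borel" unfolding H_def by measurable

  define f where "f q = c q * (vorticity \<phi> l u (snd q) (fst q)
      \<bullet> curl (tensor_divergence (stress \<phi> l u (snd q))) (fst q))" for q
  have slice_bound: "ennreal \<bar>LINT x|lborel. f (x, t)\<bar> \<le> (\<integral>\<^sup>+x. H (x, t) \<partial>lborel)" for t
  proof -
    interpret filtered_slice "rescale \<phi> l" "u t" by (rule slice)
    have "ennreal \<bar>LINT x|lborel. f (x, t)\<bar> \<le> (\<integral>\<^sup>+x. ennreal (c (x, t) * (norm (curl (curl U) x)
          * norm (tensor_divergence R x))
        + norm (grad (\<lambda>y. c (y, t)) x) * (norm (curl U x) * norm (tensor_divergence R x))) \<partial>lborel)"
      using integral_cutoff_curl_bound[of "\<lambda>x. c (x, t)" "curl U" "tensor_divergence R"]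
        C1_cutoff[OF \<theta>] bounded_support_cutoff[OF \<theta>] c0 C1_curl_U C1_div_R
      by (simp add: f_def c_def vorticity_eq stress_eq)
    also have "\<dots> \<le> (\<integral>\<^sup>+x. H (x, t) \<partial>lborel)"
      unfolding H
    proof (intro nn_integral_mono ennreal_leI)
      fix x :: "real^3"
      define q where "q = (x, t)"
      define a where "a = norm (curl (curl U) x)"
      have JVOq: "J q = norm (jacobian (curl U) (at x))" "V q = norm (tensor_divergence R x)"
        "W q = norm (curl U x)"
        by (simp_all add: J_def V_def W_def q_def vorticity_eq stress_eq)
      have "a * V q \<le> \<eta> / 2 * a\<^sup>2 + (V q)\<^sup>2 / (2 * \<eta>)"
        by (rule young_weighted[OF \<eta>])
      also have "\<dots> \<le> \<eta> * (J q)\<^sup>2 + (V q)\<^sup>2 / (2 * \<eta>)"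
        using mult_left_mono[OF norm_curl_curl_U[of x], of "\<eta> / 2"] \<eta> by (simp add: a_def JVOq)
      finally have 1: "c q * (a * V q) \<le> \<eta> * h1 q + 1 / (2 * \<eta>) * h2 q"
        using mult_left_mono[OF _ c0[of q]] by (fastforce simp: h_defs algebra_simps)
      have 2: "norm (grad (\<lambda>y. c (y, t)) x) * (W q * V q) \<le> C / (2 * r\<^sup>2) * h3 q + C / 2 * h4 q"
      proof (cases "q \<in> shell \<theta> x0 t0 k")
        case True
        then have Sq: "S q = 1" by (simp add: S_def)
        have "norm (grad (\<lambda>y. c (y, t)) x) * (W q * V q) \<le> C / r * (W q * V q)"
          using grad[of t x] by (intro mult_right_mono) (simp_all add: c_def r_def JVOq)
        \<comment> \<open>The factor 1/r goes to the vorticity and Young's inequality is taken with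
          weight one. After multiplication by r this produces the factors r^-1 and r of the shell
          budget.\<close>
        also have "\<dots> = C * ((W q / r) * V q)" by simp
        also have "\<dots> \<le> C * (1 / 2 * (W q / r)\<^sup>2 + (V q)\<^sup>2 / (2 * 1))"
          using C young_weighted[of 1 "W q / r" "V q"] by (intro mult_left_mono) auto
        also have "\<dots> = C / (2 * r\<^sup>2) * h3 q + C / 2 * h4 q"
          using r by (simp add: h_defs Sq power_divide field_simps)
        finally show ?thesis .
      next
        case False
        then have "grad (\<lambda>y. c (y, t)) x = 0"
          unfolding c_def q_def by (rule grad_cutoff_outside_shell[OF \<theta>])
        then show ?thesis using h0[of q] C by simp
      qed
      show "c (x, t) * (norm (curl (curl U) x) * norm (tensor_divergence R x))
          + norm (grad (\<lambda>y. c (y, t)) x) * (norm (curl U x) * norm (tensor_divergence R x))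
        \<le> \<eta> * h1 (x, t) + 1 / (2 * \<eta>) * h2 (x, t) + C / (2 * r\<^sup>2) * h3 (x, t) + C / 2 * h4 (x, t)"
        using 1 2 unfolding JVOq a_def by (simp add: q_def)
    qed
    finally show ?thesis .
  qed

  \<comment> \<open>The cutoff vanishes off the cylinder, so the integral extends to all of
    space-time, where its slices are integrals over the whole space.\<close>
  have "set_lebesgue_integral lborel (cylinder x0 t0 k) (\<lambda>(x, t).
       cutoff \<theta> x0 t0 k (x, t) *
       (vorticity \<phi> l u t x \<bullet> curl (tensor_divergence (stress \<phi> l u t)) x)) = (LINT q|lborel. f q)"
    unfolding set_lebesgue_integral_def f_def c_def
    by (intro Bochner_Integration.integral_cong refl)
      (auto simp: indicator_def cutoff_outside[OF \<theta>])
  then have "ennreal (F_com \<phi> \<theta> x0 t0 \<sigma> u k) = ennreal r * ennreal \<bar>LINT q|lborel. f q\<bar>"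
    using r by (simp add: F_com_def \<sigma>[symmetric] r_def Let_def ennreal_mult)
  also have "\<dots> \<le> ennreal r * (\<integral>\<^sup>+q. H q \<partial>lborel)"
    by (intro mult_left_mono abs_integral_le_iterated slice_bound Hm) simp
  also have "(\<integral>\<^sup>+q. H q \<partial>lborel) = ennreal \<eta> * (\<integral>\<^sup>+q. ennreal (h1 q) \<partial>lborel)
      + ennreal (1 / (2 * \<eta>)) * (\<integral>\<^sup>+q. ennreal (h2 q) \<partial>lborel)
      + ennreal (C / (2 * r\<^sup>2)) * (\<integral>\<^sup>+q. ennreal (h3 q) \<partial>lborel)
      + ennreal (C / 2) * (\<integral>\<^sup>+q. ennreal (h4 q) \<partial>lborel)"
    unfolding H_def by (simp add: nn_integral_add nn_integral_cmult)
  also have "ennreal r * \<dots> = ennreal \<eta> * (ennreal r * (\<integral>\<^sup>+q. ennreal (h1 q) \<partial>lborel))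
      + ennreal (1 / (2 * \<eta>)) * (ennreal r * (\<integral>\<^sup>+q. ennreal (h2 q) \<partial>lborel))
      + (ennreal r * ennreal (C / (2 * r\<^sup>2)) * (\<integral>\<^sup>+q. ennreal (h3 q) \<partial>lborel)
        + ennreal r * ennreal (C / 2) * (\<integral>\<^sup>+q. ennreal (h4 q) \<partial>lborel))"
    by (simp add: algebra_simps)
  also have "\<dots> \<le> ennreal \<eta> * P_pal \<phi> \<theta> x0 t0 \<sigma> u k
      + ennreal ((grad_L1 \<phi>)\<^sup>2 / \<eta>) * S_tilde \<phi> \<theta> x0 t0 \<sigma> p u k
      + L_inc C \<phi> \<theta> x0 t0 \<sigma> u k"
  proof (intro add_mono)
    have "(\<integral>\<^sup>+q. ennreal (h1 q) \<partial>lborel) = (\<integral>\<^sup>+q. ennreal (c q * (J q)\<^sup>2) * indicator (cylinder x0 t0 k) q \<partial>lborel)"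
      by (intro nn_integral_cong) (auto simp: h1_def c_def indicator_def cutoff_outside[OF \<theta>])
    then show "ennreal \<eta> * (ennreal r * (\<integral>\<^sup>+q. ennreal (h1 q) \<partial>lborel)) \<le> ennreal \<eta> * P_pal \<phi> \<theta> x0 t0 \<sigma> u k"
      by (simp add: P_pal_def \<sigma>[symmetric] r_def c_def J_def case_prod_unfold)
    have "ennreal (1 / (2 * \<eta>)) * (ennreal r * (\<integral>\<^sup>+q. ennreal (h2 q) \<partial>lborel))
        \<le> ennreal (1 / \<eta>) * (ennreal ((grad_L1 \<phi>)\<^sup>2) * S_tilde \<phi> \<theta> x0 t0 \<sigma> p u k)"
      unfolding S_tilde_def h2_def V_def r_def c_def[symmetric]
      using \<eta> by (intro mult_mono weighted_div_stress_le[OF \<sigma> p cm c0] ennreal_leI) (auto simp: field_simps)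
    then show "ennreal (1 / (2 * \<eta>)) * (ennreal r * (\<integral>\<^sup>+q. ennreal (h2 q) \<partial>lborel))
        \<le> ennreal ((grad_L1 \<phi>)\<^sup>2 / \<eta>) * S_tilde \<phi> \<theta> x0 t0 \<sigma> p u k"
      using \<eta> by (simp add: mult.assoc[symmetric] ennreal_mult[symmetric])
    have ind: "ennreal (S q * x) = ennreal x * indicator (shell \<theta> x0 t0 k) q" for q x
      by (simp add: S_def indicator_def)
    show "ennreal r * ennreal (C / (2 * r\<^sup>2)) * (\<integral>\<^sup>+q. ennreal (h3 q) \<partial>lborel)
        + ennreal r * ennreal (C / 2) * (\<integral>\<^sup>+q. ennreal (h4 q) \<partial>lborel) \<le> L_inc C \<phi> \<theta> x0 t0 \<sigma> u k"
      unfolding L_inc_def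
    proof (intro add_mono mult_mono)
      \<comment> \<open>The halves from Young's inequality are given away, here and in the next
        bound, so that the gradient constant itself can serve as the shell constant.\<close>
      show "ennreal r * ennreal (C / (2 * r\<^sup>2)) \<le> ennreal (C / radius k)"
        using r C by (simp add: r_def[symmetric] ennreal_mult[symmetric] ennreal_leI field_simps power2_eq_square)
      show "ennreal r * ennreal (C / 2) \<le> ennreal (C * radius k)"
        using r C by (simp add: r_def[symmetric] ennreal_mult[symmetric] ennreal_leI field_simps)
      show "(\<integral>\<^sup>+q. ennreal (h3 q) \<partial>lborel) \<le> shell_vorticity \<phi> \<theta> x0 t0 \<sigma> u k"
        by (simp add: shell_vorticity_def h3_def ind W_def \<sigma>[symmetric] case_prod_unfold)
      show "(\<integral>\<^sup>+q. ennreal (h4 q) \<partial>lborel) \<le> shell_stress \<phi> \<theta> x0 t0 \<sigma> u k"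
        by (simp add: shell_stress_def h4_def ind V_def \<sigma>[symmetric] case_prod_unfold)
    qed auto
  qed
  finally show ?thesis .
qed

lemma (in filtered_flow) shell_stress_le:
  assumes \<theta>: "cutoff_profile \<theta>" and \<sigma>: "l = \<sigma> * radius k" and p: "2 \<le> p"
  shows "ennreal (radius k) * shell_stress \<phi> \<theta> x0 t0 \<sigma> u k
    \<le> ennreal ((grad_L1 \<phi>)\<^sup>2) * S_tilde_shell \<phi> \<theta> x0 t0 \<sigma> p u k"
proof -
  have "(indicator (shell \<theta> x0 t0 k) :: _ \<Rightarrow> real) \<in> borel_measurable borel"
    using closed_shell[OF \<theta>] by (intro borel_measurable_indicator) auto
  note weighted_div_stress_le[OF \<sigma> p this]
  moreover have "shell_stress \<phi> \<theta> x0 t0 \<sigma> u k = (\<integral>\<^sup>+q. ennreal (indicator (shell \<theta> x0 t0 k) q *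
      (norm (tensor_divergence (stress \<phi> l u (snd q)) (fst q)))\<^sup>2) \<partial>lborel)"
    unfolding shell_stress_def \<sigma>[symmetric] case_prod_unfold
    by (intro nn_integral_cong) (simp add: indicator_def)
  ultimately show ?thesis by (simp add: S_tilde_shell_def)
qed

section \<open>Restriction to the time interval\<close>

context
  fixes u u' :: "real \<Rightarrow> real^3 \<Rightarrow> real^3" and t0 :: real
  assumes eq: "\<And>t. t \<in> {t0 - 1<..<t0} \<Longrightarrow> u t = u' t"
begin

lemma vorticity_cong: "t \<in> {t0 - 1<..<t0} \<Longrightarrow> vorticity \<phi> l u t = vorticity \<phi> l u' t"
  by (simp add: vorticity_def filtered_def eq)

lemma stress_cong: "t \<in> {t0 - 1<..<t0} \<Longrightarrow> stress \<phi> l u t = stress \<phi> l u' t"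
  by (simp add: fun_eq_iff stress_def filtered_def eq)

lemma increment_defect_cong:
  "t \<in> {t0 - 1<..<t0} \<Longrightarrow> increment_defect \<phi> l p u x t = increment_defect \<phi> l p u' x t"
  by (simp add: increment_defect_def increment_def eq)

lemma F_com_cong: "F_com \<phi> \<theta> x0 t0 \<sigma> u k = F_com \<phi> \<theta> x0 t0 \<sigma> u' k"
  unfolding F_com_def Let_def set_lebesgue_integral_def
  by (intro arg_cong2[where f = "(*)"] refl arg_cong[where f = abs] Bochner_Integration.integral_cong)
    (auto simp: indicator_def dest!: cylinder_time simp: vorticity_cong stress_cong)

lemma P_pal_cong: "P_pal \<phi> \<theta> x0 t0 \<sigma> u k = P_pal \<phi> \<theta> x0 t0 \<sigma> u' k"
  unfolding P_pal_def
  by (rule arg_cong[where f = "\<lambda>a. ennreal (radius k) * a"], rule nn_integral_cong)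
    (auto simp: indicator_def dest!: cylinder_time simp: vorticity_cong)

lemma weighted_defect_cong:
  assumes "\<And>q. q \<notin> cylinder x0 t0 k \<Longrightarrow> w q = 0"
  shows "weighted_defect \<phi> \<sigma> p w u k = weighted_defect \<phi> \<sigma> p w u' k"
proof -
  have "ennreal (w (x, t)) * increment_defect \<phi> (\<sigma> * radius k) p u x t ^ 4
      = ennreal (w (x, t)) * increment_defect \<phi> (\<sigma> * radius k) p u' x t ^ 4" for x t
    using assms[of "(x, t)"] cylinder_time[of x t x0 t0 k] increment_defect_cong by fastforce
  then show ?thesis by (simp add: weighted_defect_def)
qed

lemma
  assumes \<theta>: "cutoff_profile \<theta>"
  shows shell_vorticity_cong: "shell_vorticity \<phi> \<theta> x0 t0 \<sigma> u k = shell_vorticity \<phi> \<theta> x0 t0 \<sigma> u' k"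
    and shell_stress_cong: "shell_stress \<phi> \<theta> x0 t0 \<sigma> u k = shell_stress \<phi> \<theta> x0 t0 \<sigma> u' k"
  unfolding shell_vorticity_def shell_stress_def
  by (intro nn_integral_cong;
      auto simp: indicator_def dest!: cylinder_time[OF subsetD[OF shell_subset_cylinder[OF \<theta>]]]
        simp: vorticity_cong stress_cong)+

lemma
  assumes \<theta>: "cutoff_profile \<theta>"
  shows S_tilde_cong: "S_tilde \<phi> \<theta> x0 t0 \<sigma> p u k = S_tilde \<phi> \<theta> x0 t0 \<sigma> p u' k"
    and S_tilde_shell_cong: "S_tilde_shell \<phi> \<theta> x0 t0 \<sigma> p u k = S_tilde_shell \<phi> \<theta> x0 t0 \<sigma> p u' k"
  unfolding S_tilde_def S_tilde_shell_def
  using shell_subset_cylinder[OF \<theta>, of x0 t0 k]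
  by (intro weighted_defect_cong cutoff_outside \<theta>; auto simp: indicator_def)+

end

text \<open>Outside \<open>I\<close> the function \<open>u\<close> is arbitrary. Replacing it by
  zero off a Borel set of times inside \<open>I\<close> gives a globally Borel field with square
  integrable slices; the flux, the defects and the shell terms do not change, since cutoff and shell
  lie in the cylinder.\<close>

lemma leray_hopf_restrict:
  assumes u: "leray_hopf I u" and J: "J \<subseteq> I" "J \<in> sets borel"
  defines "u' \<equiv> (\<lambda>t. if t \<in> J then u t else (\<lambda>_. 0))"
  shows "(\<lambda>(x, t). u' t x) \<in> borel_measurable borel" "square_integrable (u' t)"
proof -
  have a: "(\<lambda>q. indicator (UNIV \<times> I) q *\<^sub>R (case q of (x, t) \<Rightarrow> u t x)) \<in> borel_measurable borel"
    using u by (simp add: leray_hopf_def set_borel_measurable_def)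
  have b: "(\<lambda>q. indicator J (snd q) :: real) \<in> borel_measurable (borel :: ((real^3) \<times> real) measure)"
    using J(2) by (intro measurable_compose[OF _ borel_measurable_indicator])
      (auto intro!: borel_measurable_continuous_onI continuous_intros)
  \<comment> \<open>Measurability is known for \<open>u\<close> times the indicator of
    \<open>I\<close>; as J \<subseteq> I, a further factor for \<open>J\<close> turns this into the
    restricted field.\<close>
  have "(\<lambda>q. (indicator J (snd q) :: real) *\<^sub>R
      (indicator (UNIV \<times> I) q *\<^sub>R (case q of (x, t) \<Rightarrow> u t x))) \<in> borel_measurable borel"
    by (rule borel_measurable_scaleR[OF b a])
  also have "(\<lambda>q. (indicator J (snd q) :: real) *\<^sub>R
      (indicator (UNIV \<times> I) q *\<^sub>R (case q of (x, t) \<Rightarrow> u t x))) = (\<lambda>(x, t). u' t x)"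
    using J(1) by (auto simp: fun_eq_iff u'_def indicator_def)
  finally show "(\<lambda>(x, t). u' t x) \<in> borel_measurable borel" .
  show "square_integrable (u' t)"
    using u J(1) by (auto simp: u'_def leray_hopf_def square_integrable_def)
qed

theorem theorem9p3:
  shows "\<exists>C_star::real. C_star > 0 \<and>
    (\<forall>\<theta>::(real^3) \<times> real \<Rightarrow> real. cutoff_profile \<theta> \<longrightarrow>
      (\<exists>C_chi::real. C_chi > 0 \<and>
        (\<forall>(\<phi>::real^3 \<Rightarrow> real) (u::real \<Rightarrow> real^3 \<Rightarrow> real^3) (I::real set)
           (x0::real^3) (t0::real) (\<sigma>::real) (k::nat) (p::real).
          filter_kernel \<phi> \<longrightarrow> leray_hopf I u \<longrightarrow> {t0 - 1<..<t0} \<subseteq> I \<longrightarrow>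
          0 < \<sigma> \<longrightarrow> \<sigma> < 1 \<longrightarrow> 2 \<le> p \<longrightarrow> p \<le> 4 \<longrightarrow>
          (\<forall>\<eta>::real. 0 < \<eta> \<longrightarrow> \<eta> < 1 \<longrightarrow>
             ennreal (F_com \<phi> \<theta> x0 t0 \<sigma> u k)
             \<le> ennreal \<eta> * P_pal \<phi> \<theta> x0 t0 \<sigma> u k
               + ennreal (C_star * (grad_L1 \<phi>)\<^sup>2 / \<eta>) * S_tilde \<phi> \<theta> x0 t0 \<sigma> p u k
               + L_inc C_chi \<phi> \<theta> x0 t0 \<sigma> u k) \<and>
          ennreal (radius k) * shell_stress \<phi> \<theta> x0 t0 \<sigma> u k
            \<le> ennreal (C_star * (grad_L1 \<phi>)\<^sup>2) * S_tilde_shell \<phi> \<theta> x0 t0 \<sigma> p u k)))"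
proof (rule exI[of _ "1::real"], intro conjI zero_less_one allI impI)
  fix \<theta> :: "(real^3) \<times> real \<Rightarrow> real"
  assume \<theta>: "cutoff_profile \<theta>"
  \<comment> \<open>Obtained before filter, solution, centre and scale are fixed, so the shell
    constant depends on the profile alone.\<close>
  obtain C where C: "0 < C"
    "\<And>x0 t0 k t x. norm (grad (\<lambda>y. cutoff \<theta> x0 t0 k (y, t)) x) \<le> C / radius k"
    using grad_cutoff_bound[OF \<theta>] by blast
  show "\<exists>C_chi::real. C_chi > 0 \<and>
        (\<forall>(\<phi>::real^3 \<Rightarrow> real) (u::real \<Rightarrow> real^3 \<Rightarrow> real^3) (I::real set)
           (x0::real^3) (t0::real) (\<sigma>::real) (k::nat) (p::real).
          filter_kernel \<phi> \<longrightarrow> leray_hopf I u \<longrightarrow> {t0 - 1<..<t0} \<subseteq> I \<longrightarrow>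
          0 < \<sigma> \<longrightarrow> \<sigma> < 1 \<longrightarrow> 2 \<le> p \<longrightarrow> p \<le> 4 \<longrightarrow>
          (\<forall>\<eta>::real. 0 < \<eta> \<longrightarrow> \<eta> < 1 \<longrightarrow>
             ennreal (F_com \<phi> \<theta> x0 t0 \<sigma> u k)
             \<le> ennreal \<eta> * P_pal \<phi> \<theta> x0 t0 \<sigma> u k
               + ennreal (1 * (grad_L1 \<phi>)\<^sup>2 / \<eta>) * S_tilde \<phi> \<theta> x0 t0 \<sigma> p u k
               + L_inc C_chi \<phi> \<theta> x0 t0 \<sigma> u k) \<and>
          ennreal (radius k) * shell_stress \<phi> \<theta> x0 t0 \<sigma> u k
            \<le> ennreal (1 * (grad_L1 \<phi>)\<^sup>2) * S_tilde_shell \<phi> \<theta> x0 t0 \<sigma> p u k)"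
  proof (rule exI[of _ C], rule conjI[OF C(1)], intro allI impI)
    fix \<phi> :: "real^3 \<Rightarrow> real" and u :: "real \<Rightarrow> real^3 \<Rightarrow> real^3" and I :: "real set"
      and x0 :: "real^3" and t0 \<sigma> :: real and k :: nat and p :: real
    assume \<phi>: "filter_kernel \<phi>" and u: "leray_hopf I u" and I: "{t0 - 1<..<t0} \<subseteq> I"
      and \<sigma>: "0 < \<sigma>" and p: "2 \<le> p"
    define u' where "u' = (\<lambda>t. if t \<in> {t0 - 1<..<t0} then u t else (\<lambda>_. 0))"
    have eq: "u t = u' t" if "t \<in> {t0 - 1<..<t0}" for t
      using that by (simp add: u'_def)
    interpret filtered_flow \<phi> "\<sigma> * radius k" u'
      using \<phi> \<sigma> radius_pos[of k] leray_hopf_restrict[OF u I]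
      by unfold_locales (auto simp: u'_def)
    have restrict: "F_com \<phi> \<theta> x0 t0 \<sigma> u k = F_com \<phi> \<theta> x0 t0 \<sigma> u' k"
      "P_pal \<phi> \<theta> x0 t0 \<sigma> u k = P_pal \<phi> \<theta> x0 t0 \<sigma> u' k"
      "S_tilde \<phi> \<theta> x0 t0 \<sigma> p u k = S_tilde \<phi> \<theta> x0 t0 \<sigma> p u' k"
      "S_tilde_shell \<phi> \<theta> x0 t0 \<sigma> p u k = S_tilde_shell \<phi> \<theta> x0 t0 \<sigma> p u' k"
      "shell_vorticity \<phi> \<theta> x0 t0 \<sigma> u k = shell_vorticity \<phi> \<theta> x0 t0 \<sigma> u' k"
      "shell_stress \<phi> \<theta> x0 t0 \<sigma> u k = shell_stress \<phi> \<theta> x0 t0 \<sigma> u' k"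
      by (rule F_com_cong P_pal_cong S_tilde_cong S_tilde_shell_cong shell_vorticity_cong
          shell_stress_cong, rule eq, assumption, (rule \<theta>)?)+
    have "ennreal (F_com \<phi> \<theta> x0 t0 \<sigma> u k)
             \<le> ennreal \<eta> * P_pal \<phi> \<theta> x0 t0 \<sigma> u k
               + ennreal (1 * (grad_L1 \<phi>)\<^sup>2 / \<eta>) * S_tilde \<phi> \<theta> x0 t0 \<sigma> p u k
               + L_inc C \<phi> \<theta> x0 t0 \<sigma> u k" if "0 < \<eta>" for \<eta>
      using F_com_le[OF \<theta> C refl p that, of x0 t0] by (simp add: L_inc_def restrict)
    moreover have "ennreal (radius k) * shell_stress \<phi> \<theta> x0 t0 \<sigma> u k
            \<le> ennreal (1 * (grad_L1 \<phi>)\<^sup>2) * S_tilde_shell \<phi> \<theta> x0 t0 \<sigma> p u k"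
      using shell_stress_le[OF \<theta> refl p, of x0 t0] by (simp add: restrict)
    ultimately show "(\<forall>\<eta>::real. 0 < \<eta> \<longrightarrow> \<eta> < 1 \<longrightarrow>
             ennreal (F_com \<phi> \<theta> x0 t0 \<sigma> u k)
             \<le> ennreal \<eta> * P_pal \<phi> \<theta> x0 t0 \<sigma> u k
               + ennreal (1 * (grad_L1 \<phi>)\<^sup>2 / \<eta>) * S_tilde \<phi> \<theta> x0 t0 \<sigma> p u k
               + L_inc C \<phi> \<theta> x0 t0 \<sigma> u k) \<and>
          ennreal (radius k) * shell_stress \<phi> \<theta> x0 t0 \<sigma> u k
            \<le> ennreal (1 * (grad_L1 \<phi>)\<^sup>2) * S_tilde_shell \<phi> \<theta> x0 t0 \<sigma> p u k"
      by blast
  qed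
qed

end
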